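(* Let $\mathcal C$ and $\mathcal D$ be strict C*-2-categories, and suppose that $\mathcal D$ is Q-system complete. Then the C*-2-category $\mathbf{Fun}(\mathcal C,\mathcal D)$ of $*$-2-functors, $*$-2-transformations and $*$-2-modifications is Q-system complete.
   Context: **2-categories.** $\mathcal C_0$ denotes the 0-cells, $\mathcal C_1(a,b)$ the 1-cells $a\to b$, $\mathcal C_2(X,Y)$ the 2-cells $X\Rightarrow Y$. Horizontal composition $\boxtimes$ is written right to left: for $X\in\mathcal C_1(a,b)$, $Y\in\mathcal C_1(b,c)$ one has $Y\boxtimes X\in\mathcal C_1(a,c)$. A C*-2-category is a 2-category whose hom-categories are C*-categories, with $\boxtimes$ bilinear on 2-cells and compatible with $*$, and with unitary coherence isomorphisms (identities in the strict case). Convention: every C*-2-category (here $\mathcal C$ and $\mathcal D$) is assumed locally orthogonal projection complete: for every 1-cell $X\in\mathcal C_1(a,b)$ and projection $p\in\mathcal C_2(X,X)$ there are $Y\in\mathcal C_1(a,b)$ and an isometry $v\in\mathcal C_2(Y,X)$ with $vv^*=p$. **Q-systems.** A Q-system is a 1-cell $Q\in\mathcal C_1(b,b)$ with 2-cells $m:Q\boxtimes Q\to Q$, $i:1_b\to Q$ such that $m(m\boxtimes 1)=m(1\boxtimes m)$; $m(i\boxtimes 1)=1_Q=m(1\boxtimes i)$; $(1\boxtimes m)(m^*\boxtimes 1)=m^*m=(m\boxtimes 1)(1\boxtimes m^* )$; $mm^*=1_Q$. A unitarily separable left dual of $X\in\mathcal C_1(c,b)$ is $\overline X\in\mathcal C_1(b,c)$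 with $ev:\overline X\boxtimes X\to 1_c$, $coev:1_b\to X\boxtimes\overline X$ satisfying the zig-zag equations and $ev\, ev^*=\mathrm{id}_{1_c}$; then $X\boxtimes\overline X$ is a Q-system with $m=1_X\boxtimes ev\boxtimes 1_{\overline X}$, $i=coev$. A Q-system $Q\in\mathcal C_1(b,b)$ splits if there are $c\in\mathcal C_0$ and $X\in\mathcal C_1(c,b)$ with a unitarily separable left dual such that $Q\cong X\boxtimes\overline X$ as Q-systems (via a unitary 2-cell intertwining multiplications and units). $\mathcal C$ is Q-system complete if the canonical inclusion $b\mapsto 1_b$ of $\mathcal C$ into its 2-category $\mathbf{QSys}(\mathcal C)$ of Q-systems, (unital, Frobenius, separable) bimodules and bimodule intertwiners is a $*$-2-equivalence; it is known that this is equivalent to: every Q-system in $\mathcal C$ splits, and this may be taken as the definition. **The 2-category $\mathbf{Fun}(\mathcal C,\mathcal D)$.** A $*$-2-functor $F:\mathcal C\to\mathcal D$ consists of a map on 0-cells, $*$-functors $\mathcal C_1(a,b)\to\mathcal D_1(F(a),F(b))$, and unitary 2-cells $F^2_{X,Y}:F(X)\boxtimes F(Y)\to F(X\boxtimes Y)$ (natural in $X,Y$) and $F^1_a:1_{F(a)}\to F(1_a)$ satisfying the usual associativity and unit coherence. A $*$-2-transformation $\phi:F\Rightarrow G$ consists of $\phi_a\in\mathcal D_1(F(a),G(a))$ for $a\in\mathcal C_0$ and unitaries $\phi_X:\phi_b\boxtimes F(X)\to G(X)\boxtimes\phi_a$ for $X\in\mathcal C_1(a,b)$ such that: $(G^2_{X,Y}\boxtimes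 1_{\phi_c})(1_{G(X)}\boxtimes\phi_Y)(\phi_X\boxtimes 1_{F(Y)})=\phi_{X\boxtimes Y}(1_{\phi_b}\boxtimes F^2_{X,Y})$ for $X\in\mathcal C_1(a,b)$, $Y\in\mathcal C_1(c,a)$; $(G(f)\boxtimes 1)\phi_X=\phi_Y(1\boxtimes F(f))$ for $f\in\mathcal C_2(X,Y)$; $G^1_a\boxtimes 1_{\phi_a}=\phi_{1_a}(1_{\phi_a}\boxtimes F^1_a)$. A $*$-2-modification $\eta:\phi\Rrightarrow\psi$ between $\phi,\psi:F\Rightarrow G$ is a family $\eta_a\in\mathcal D_2(\phi_a,\psi_a)$ with $\sup_a\|\eta_a\|<\infty$ and $\psi_X(\eta_b\boxtimes 1_{F(X)})=(1_{G(X)}\boxtimes\eta_a)\phi_X$ for all $X\in\mathcal C_1(a,b)$. Horizontal composition of $\psi:H\Rightarrow G$ and $\phi:G\Rightarrow F$: $(\phi\otimes\psi)_a=\phi_a\boxtimes\psi_a$, $(\phi\otimes\psi)_X=(\phi_X\boxtimes 1_{\psi_a})(1_{\phi_b}\boxtimes\psi_X)$; for modifications $(n\otimes t)_a=n_a\boxtimes t_a$; vertical composition and $*$ are componentwise. It is known that $\mathbf{Fun}(\mathcal C,\mathcal D)$ is a C*-2-category. *)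

theory Defs
  imports "HOL-Analysis.Analysis"
begin

section \<open>C*-categories\<close>

locale complex_banach_space_on =
  fixes V :: "'c set"
    and zero :: 'c
    and add :: "'c \<Rightarrow> 'c \<Rightarrow> 'c"
    and scale :: "complex \<Rightarrow> 'c \<Rightarrow> 'c"
    and nrm :: "'c \<Rightarrow> real"
  assumes zero_closed: "zero \<in> V"
    and add_closed: "\<lbrakk>f \<in> V; g \<in> V\<rbrakk> \<Longrightarrow> add f g \<in> V"
    and scale_closed: "f \<in> V \<Longrightarrow> scale z f \<in> V"
    and add_assoc: "\<lbrakk>f \<in> V; g \<in> V; h \<in> V\<rbrakk> \<Longrightarrow> add (add f g) h = add f (add g h)"
    and add_commute: "\<lbrakk>f \<in> V; g \<in> V\<rbrakk> \<Longrightarrow> add f g = add g f"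
    and add_zero: "f \<in> V \<Longrightarrow> add f zero = f"
    and add_inverse: "f \<in> V \<Longrightarrow> add f (scale (-1) f) = zero"
    and scale_add_right: "\<lbrakk>f \<in> V; g \<in> V\<rbrakk> \<Longrightarrow> scale z (add f g) = add (scale z f) (scale z g)"
    and scale_add_left: "f \<in> V \<Longrightarrow> scale (z + w) f = add (scale z f) (scale w f)"
    and scale_scale: "f \<in> V \<Longrightarrow> scale z (scale w f) = scale (z * w) f"
    and scale_one: "f \<in> V \<Longrightarrow> scale 1 f = f"
    and nrm_nonneg: "f \<in> V \<Longrightarrow> 0 \<le> nrm f"
    and nrm_eq_zero: "f \<in> V \<Longrightarrow> nrm f = 0 \<longleftrightarrow> f = zero"
    and nrm_scale: "f \<in> V \<Longrightarrow> nrm (scale z f) = cmod z * nrm f"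
    and nrm_triangle: "\<lbrakk>f \<in> V; g \<in> V\<rbrakk> \<Longrightarrow> nrm (add f g) \<le> nrm f + nrm g"
    and complete: "Metric_space.mcomplete V (\<lambda>f g. nrm (add f (scale (-1) g)))"

text \<open>Addition, scalar multiplication, involution and norm carry no object indices: the
  hom-sets of a \<open>two_cat\<close> (below) are disjoint.\<close>

locale cstar_category =
  fixes Obj :: "'m set"
    and Hom :: "'m \<Rightarrow> 'm \<Rightarrow> 'c set"
    and idn :: "'m \<Rightarrow> 'c"
    and cmp :: "'c \<Rightarrow> 'c \<Rightarrow> 'c"
    and zero :: "'m \<Rightarrow> 'm \<Rightarrow> 'c"
    and add :: "'c \<Rightarrow> 'c \<Rightarrow> 'c"
    and scale :: "complex \<Rightarrow> 'c \<Rightarrow> 'c"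
    and star :: "'c \<Rightarrow> 'c"
    and nrm :: "'c \<Rightarrow> real"
  assumes idn_in: "X \<in> Obj \<Longrightarrow> idn X \<in> Hom X X"
    and cmp_in: "\<lbrakk>X \<in> Obj; Y \<in> Obj; Z \<in> Obj; f \<in> Hom X Y; g \<in> Hom Y Z\<rbrakk>
      \<Longrightarrow> cmp g f \<in> Hom X Z"
    and cmp_assoc: "\<lbrakk>X \<in> Obj; Y \<in> Obj; Z \<in> Obj; W \<in> Obj; f \<in> Hom X Y; g \<in> Hom Y Z; h \<in> Hom Z W\<rbrakk>
      \<Longrightarrow> cmp (cmp h g) f = cmp h (cmp g f)"
    and cmp_idn_left: "\<lbrakk>X \<in> Obj; Y \<in> Obj; f \<in> Hom X Y\<rbrakk> \<Longrightarrow> cmp (idn Y) f = f"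
    and cmp_idn_right: "\<lbrakk>X \<in> Obj; Y \<in> Obj; f \<in> Hom X Y\<rbrakk> \<Longrightarrow> cmp f (idn X) = f"
    and hom_banach: "\<lbrakk>X \<in> Obj; Y \<in> Obj\<rbrakk>
      \<Longrightarrow> complex_banach_space_on (Hom X Y) (zero X Y) add scale nrm"
    and cmp_add_left: "\<lbrakk>X \<in> Obj; Y \<in> Obj; Z \<in> Obj; f \<in> Hom X Y; g \<in> Hom Y Z; g' \<in> Hom Y Z\<rbrakk>
      \<Longrightarrow> cmp (add g g') f = add (cmp g f) (cmp g' f)"
    and cmp_add_right: "\<lbrakk>X \<in> Obj; Y \<in> Obj; Z \<in> Obj; f \<in> Hom X Y; f' \<in> Hom X Y; g \<in> Hom Y Z\<rbrakk>
      \<Longrightarrow> cmp g (add f f') = add (cmp g f) (cmp g f')"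
    and cmp_scale_left: "\<lbrakk>X \<in> Obj; Y \<in> Obj; Z \<in> Obj; f \<in> Hom X Y; g \<in> Hom Y Z\<rbrakk>
      \<Longrightarrow> cmp (scale z g) f = scale z (cmp g f)"
    and cmp_scale_right: "\<lbrakk>X \<in> Obj; Y \<in> Obj; Z \<in> Obj; f \<in> Hom X Y; g \<in> Hom Y Z\<rbrakk>
      \<Longrightarrow> cmp g (scale z f) = scale z (cmp g f)"
    and star_in: "\<lbrakk>X \<in> Obj; Y \<in> Obj; f \<in> Hom X Y\<rbrakk> \<Longrightarrow> star f \<in> Hom Y X"
    and star_star: "\<lbrakk>X \<in> Obj; Y \<in> Obj; f \<in> Hom X Y\<rbrakk> \<Longrightarrow> star (star f) = f"
    and star_cmp: "\<lbrakk>X \<in> Obj; Y \<in> Obj; Z \<in> Obj; f \<in> Hom X Y; g \<in> Hom Y Z\<rbrakk>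
      \<Longrightarrow> star (cmp g f) = cmp (star f) (star g)"
    and star_add: "\<lbrakk>X \<in> Obj; Y \<in> Obj; f \<in> Hom X Y; g \<in> Hom X Y\<rbrakk>
      \<Longrightarrow> star (add f g) = add (star f) (star g)"
    and star_scale: "\<lbrakk>X \<in> Obj; Y \<in> Obj; f \<in> Hom X Y\<rbrakk>
      \<Longrightarrow> star (scale z f) = scale (cnj z) (star f)"
    and nrm_cmp: "\<lbrakk>X \<in> Obj; Y \<in> Obj; Z \<in> Obj; f \<in> Hom X Y; g \<in> Hom Y Z\<rbrakk>
      \<Longrightarrow> nrm (cmp g f) \<le> nrm g * nrm f"
    and cstar_identity: "\<lbrakk>X \<in> Obj; Y \<in> Obj; f \<in> Hom X Y\<rbrakk>
      \<Longrightarrow> nrm (cmp (star f) f) = (nrm f)\<^sup>2"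
    and star_cmp_positive: "\<lbrakk>X \<in> Obj; Y \<in> Obj; f \<in> Hom X Y\<rbrakk>
      \<Longrightarrow> \<exists>g \<in> Hom X X. cmp (star f) f = cmp (star g) g"


section \<open>Strict C*-2-categories\<close>

text \<open>Both compositions are written right to left: \<open>Y \<boxdot> X\<close> (1-cells), \<open>g \<boxtimes> f\<close> (2-cells,
  horizontal) and \<open>g \<cdot> f\<close> (2-cells, vertical) are ``first the right factor''.\<close>

record ('o, 'm, 'c) two_cat =
  Ob0 :: "'o set"
  Ob1 :: "'m set"
  Ob2 :: "'c set"
  src1 :: "'m \<Rightarrow> 'o"
  tgt1 :: "'m \<Rightarrow> 'o"
  src2 :: "'c \<Rightarrow> 'm"
  tgt2 :: "'c \<Rightarrow> 'm"
  id1 :: "'o \<Rightarrow> 'm"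
  id2 :: "'m \<Rightarrow> 'c"
  hcomp1 :: "'m \<Rightarrow> 'm \<Rightarrow> 'm"  (infixl "\<boxdot>\<index>" 75)
  hcomp2 :: "'c \<Rightarrow> 'c \<Rightarrow> 'c"  (infixl "\<boxtimes>\<index>" 75)
  vcomp :: "'c \<Rightarrow> 'c \<Rightarrow> 'c"  (infixl "\<cdot>\<index>" 70)
  zero2 :: "'m \<Rightarrow> 'm \<Rightarrow> 'c"
  add2 :: "'c \<Rightarrow> 'c \<Rightarrow> 'c"
  scale2 :: "complex \<Rightarrow> 'c \<Rightarrow> 'c"
  star2 :: "'c \<Rightarrow> 'c"
  norm2 :: "'c \<Rightarrow> real"

definition cells1 :: "('o, 'm, 'c) two_cat \<Rightarrow> 'o \<Rightarrow> 'o \<Rightarrow> 'm set" where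
  "cells1 C a b = {X \<in> Ob1 C. src1 C X = a \<and> tgt1 C X = b}"

definition cells2 :: "('o, 'm, 'c) two_cat \<Rightarrow> 'm \<Rightarrow> 'm \<Rightarrow> 'c set" where
  "cells2 C X Y = {f \<in> Ob2 C. src2 C f = X \<and> tgt2 C f = Y}"

locale strict_2category =
  fixes C :: "('o, 'm, 'c) two_cat" (structure)
  assumes src1_in: "X \<in> Ob1 C \<Longrightarrow> src1 C X \<in> Ob0 C"
    and tgt1_in: "X \<in> Ob1 C \<Longrightarrow> tgt1 C X \<in> Ob0 C"
    and src2_in: "f \<in> Ob2 C \<Longrightarrow> src2 C f \<in> Ob1 C"
    and tgt2_in: "f \<in> Ob2 C \<Longrightarrow> tgt2 C f \<in> Ob1 C"
    and src1_parallel: "f \<in> Ob2 C \<Longrightarrow> src1 C (src2 C f) = src1 C (tgt2 C f)"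
    and tgt1_parallel: "f \<in> Ob2 C \<Longrightarrow> tgt1 C (src2 C f) = tgt1 C (tgt2 C f)"
    and id2_in: "X \<in> Ob1 C \<Longrightarrow> id2 C X \<in> cells2 C X X"
    and vcomp_in: "\<lbrakk>f \<in> cells2 C X Y; g \<in> cells2 C Y Z\<rbrakk> \<Longrightarrow> g \<cdot> f \<in> cells2 C X Z"
    and vcomp_assoc: "\<lbrakk>f \<in> cells2 C X Y; g \<in> cells2 C Y Z; h \<in> cells2 C Z W\<rbrakk>
      \<Longrightarrow> (h \<cdot> g) \<cdot> f = h \<cdot> (g \<cdot> f)"
    and vcomp_id2_left: "f \<in> cells2 C X Y \<Longrightarrow> id2 C Y \<cdot> f = f"
    and vcomp_id2_right: "f \<in> cells2 C X Y \<Longrightarrow> f \<cdot> id2 C X = f"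
    and id1_in: "a \<in> Ob0 C \<Longrightarrow> id1 C a \<in> cells1 C a a"
    and hcomp1_in: "\<lbrakk>X \<in> cells1 C a b; Y \<in> cells1 C b c\<rbrakk> \<Longrightarrow> Y \<boxdot> X \<in> cells1 C a c"
    and hcomp1_assoc: "\<lbrakk>X \<in> cells1 C a b; Y \<in> cells1 C b c; Z \<in> cells1 C c d\<rbrakk>
      \<Longrightarrow> (Z \<boxdot> Y) \<boxdot> X = Z \<boxdot> (Y \<boxdot> X)"
    and hcomp1_id1_left: "X \<in> cells1 C a b \<Longrightarrow> id1 C b \<boxdot> X = X"
    and hcomp1_id1_right: "X \<in> cells1 C a b \<Longrightarrow> X \<boxdot> id1 C a = X"
    and hcomp2_in: "\<lbrakk>X \<in> cells1 C a b; Y \<in> cells1 C b c; f \<in> cells2 C X X'; g \<in> cells2 C Y Y'\<rbrakk>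
      \<Longrightarrow> g \<boxtimes> f \<in> cells2 C (Y \<boxdot> X) (Y' \<boxdot> X')"
    and hcomp2_assoc: "\<lbrakk>X \<in> cells1 C a b; Y \<in> cells1 C b c; Z \<in> cells1 C c d;
        f \<in> cells2 C X X'; g \<in> cells2 C Y Y'; h \<in> cells2 C Z Z'\<rbrakk>
      \<Longrightarrow> (h \<boxtimes> g) \<boxtimes> f = h \<boxtimes> (g \<boxtimes> f)"
    and hcomp2_id_left: "\<lbrakk>X \<in> cells1 C a b; f \<in> cells2 C X X'\<rbrakk>
      \<Longrightarrow> id2 C (id1 C b) \<boxtimes> f = f"
    and hcomp2_id_right: "\<lbrakk>X \<in> cells1 C a b; f \<in> cells2 C X X'\<rbrakk>
      \<Longrightarrow> f \<boxtimes> id2 C (id1 C a) = f"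
    and hcomp2_id2: "\<lbrakk>X \<in> cells1 C a b; Y \<in> cells1 C b c\<rbrakk>
      \<Longrightarrow> id2 C Y \<boxtimes> id2 C X = id2 C (Y \<boxdot> X)"
    and interchange: "\<lbrakk>X \<in> cells1 C a b; Y \<in> cells1 C b c;
        f \<in> cells2 C X X'; f' \<in> cells2 C X' X''; g \<in> cells2 C Y Y'; g' \<in> cells2 C Y' Y''\<rbrakk>
      \<Longrightarrow> (g' \<cdot> g) \<boxtimes> (f' \<cdot> f) = (g' \<boxtimes> f') \<cdot> (g \<boxtimes> f)"

locale strict_cstar_2category = strict_2category +
  assumes hom_cstar_category: "\<lbrakk>a \<in> Ob0 C; b \<in> Ob0 C\<rbrakk>
      \<Longrightarrow> cstar_category (cells1 C a b) (cells2 C) (id2 C) (vcomp C)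
            (zero2 C) (add2 C) (scale2 C) (star2 C) (norm2 C)"
    and hcomp2_add_left: "\<lbrakk>X \<in> cells1 C a b; Y \<in> cells1 C b c;
        f \<in> cells2 C X X'; g \<in> cells2 C Y Y'; g' \<in> cells2 C Y Y'\<rbrakk>
      \<Longrightarrow> add2 C g g' \<boxtimes> f = add2 C (g \<boxtimes> f) (g' \<boxtimes> f)"
    and hcomp2_add_right: "\<lbrakk>X \<in> cells1 C a b; Y \<in> cells1 C b c;
        f \<in> cells2 C X X'; f' \<in> cells2 C X X'; g \<in> cells2 C Y Y'\<rbrakk>
      \<Longrightarrow> g \<boxtimes> add2 C f f' = add2 C (g \<boxtimes> f) (g \<boxtimes> f')"
    and hcomp2_scale_left: "\<lbrakk>X \<in> cells1 C a b; Y \<in> cells1 C b c;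
        f \<in> cells2 C X X'; g \<in> cells2 C Y Y'\<rbrakk>
      \<Longrightarrow> scale2 C z g \<boxtimes> f = scale2 C z (g \<boxtimes> f)"
    and hcomp2_scale_right: "\<lbrakk>X \<in> cells1 C a b; Y \<in> cells1 C b c;
        f \<in> cells2 C X X'; g \<in> cells2 C Y Y'\<rbrakk>
      \<Longrightarrow> g \<boxtimes> scale2 C z f = scale2 C z (g \<boxtimes> f)"
    and star2_hcomp2: "\<lbrakk>X \<in> cells1 C a b; Y \<in> cells1 C b c;
        f \<in> cells2 C X X'; g \<in> cells2 C Y Y'\<rbrakk>
      \<Longrightarrow> star2 C (g \<boxtimes> f) = star2 C g \<boxtimes> star2 C f"


section \<open>Projections and Q-systems\<close>

context
  fixes C :: "('o, 'm, 'c) two_cat" (structure)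
begin

definition isometry2 :: "'m \<Rightarrow> 'm \<Rightarrow> 'c \<Rightarrow> bool" where
  "isometry2 X Y v \<longleftrightarrow> v \<in> cells2 C X Y \<and> star2 C v \<cdot> v = id2 C X"

definition unitary2 :: "'m \<Rightarrow> 'm \<Rightarrow> 'c \<Rightarrow> bool" where
  "unitary2 X Y u \<longleftrightarrow>
     u \<in> cells2 C X Y \<and> star2 C u \<cdot> u = id2 C X \<and> u \<cdot> star2 C u = id2 C Y"

definition projection2 :: "'m \<Rightarrow> 'c \<Rightarrow> bool" where
  "projection2 X p \<longleftrightarrow> p \<in> cells2 C X X \<and> p \<cdot> p = p \<and> star2 C p = p"

definition locally_projection_complete :: bool where
  "locally_projection_complete \<longleftrightarrow>
     (\<forall>a b. \<forall>X \<in> cells1 C a b. \<forall>p. projection2 X p \<longrightarrow>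
        (\<exists>Y \<in> cells1 C a b. \<exists>v. isometry2 Y X v \<and> v \<cdot> star2 C v = p))"

definition q_system :: "'o \<Rightarrow> 'm \<Rightarrow> 'c \<Rightarrow> 'c \<Rightarrow> bool" where
  "q_system b Q m i \<longleftrightarrow>
     b \<in> Ob0 C \<and> Q \<in> cells1 C b b \<and> m \<in> cells2 C (Q \<boxdot> Q) Q \<and> i \<in> cells2 C (id1 C b) Q \<and>
     m \<cdot> (m \<boxtimes> id2 C Q) = m \<cdot> (id2 C Q \<boxtimes> m) \<and>
     m \<cdot> (i \<boxtimes> id2 C Q) = id2 C Q \<and>
     m \<cdot> (id2 C Q \<boxtimes> i) = id2 C Q \<and>
     (id2 C Q \<boxtimes> m) \<cdot> (star2 C m \<boxtimes> id2 C Q) = star2 C m \<cdot> m \<and>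
     (m \<boxtimes> id2 C Q) \<cdot> (id2 C Q \<boxtimes> star2 C m) = star2 C m \<cdot> m \<and>
     m \<cdot> star2 C m = id2 C Q"

definition unitarily_separable_left_dual ::
  "'o \<Rightarrow> 'o \<Rightarrow> 'm \<Rightarrow> 'm \<Rightarrow> 'c \<Rightarrow> 'c \<Rightarrow> bool" where
  "unitarily_separable_left_dual c b X X' ev coev \<longleftrightarrow>
     X \<in> cells1 C c b \<and> X' \<in> cells1 C b c \<and>
     ev \<in> cells2 C (X' \<boxdot> X) (id1 C c) \<and> coev \<in> cells2 C (id1 C b) (X \<boxdot> X') \<and>
     (id2 C X \<boxtimes> ev) \<cdot> (coev \<boxtimes> id2 C X) = id2 C X \<and>
     (ev \<boxtimes> id2 C X') \<cdot> (id2 C X' \<boxtimes> coev) = id2 C X' \<and>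
     ev \<cdot> star2 C ev = id2 C (id1 C c)"

definition q_system_iso ::
  "'m \<Rightarrow> 'c \<Rightarrow> 'c \<Rightarrow> 'm \<Rightarrow> 'c \<Rightarrow> 'c \<Rightarrow> 'c \<Rightarrow> bool" where
  "q_system_iso Q m i Q' m' i' u \<longleftrightarrow>
     unitary2 Q Q' u \<and> u \<cdot> m = m' \<cdot> (u \<boxtimes> u) \<and> u \<cdot> i = i'"

definition q_system_splits :: "'o \<Rightarrow> 'm \<Rightarrow> 'c \<Rightarrow> 'c \<Rightarrow> bool" where
  "q_system_splits b Q m i \<longleftrightarrow>
     (\<exists>c \<in> Ob0 C. \<exists>X X' ev coev u.
        unitarily_separable_left_dual c b X X' ev coev \<and>
        q_system_iso Q m i (X \<boxdot> X') (id2 C X \<boxtimes> ev \<boxtimes> id2 C X') coev u)"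

definition q_system_complete :: bool where
  "q_system_complete \<longleftrightarrow> (\<forall>b Q m i. q_system b Q m i \<longrightarrow> q_system_splits b Q m i)"

end


section \<open>*-2-functors, *-2-transformations, *-2-modifications\<close>

text \<open>\<open>funmu F X Y\<close> is $F^2_{X,Y}$ and \<open>funeta F a\<close> is $F^1_a$.\<close>

record ('o, 'm, 'c, 'p, 'n, 'd) two_functor =
  fun0 :: "'o \<Rightarrow> 'p"
  fun1 :: "'m \<Rightarrow> 'n"
  fun2 :: "'c \<Rightarrow> 'd"
  funmu :: "'m \<Rightarrow> 'm \<Rightarrow> 'd"
  funeta :: "'o \<Rightarrow> 'd"

locale star_2_functor = C: strict_cstar_2category C + D: strict_cstar_2category D
  for C :: "('o, 'm, 'c) two_cat" and D :: "('p, 'n, 'd) two_cat" +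
  fixes F :: "('o, 'm, 'c, 'p, 'n, 'd) two_functor"
  assumes fun0_in: "a \<in> Ob0 C \<Longrightarrow> fun0 F a \<in> Ob0 D"
    and fun1_in: "X \<in> cells1 C a b \<Longrightarrow> fun1 F X \<in> cells1 D (fun0 F a) (fun0 F b)"
    and fun2_in: "f \<in> cells2 C X Y \<Longrightarrow> fun2 F f \<in> cells2 D (fun1 F X) (fun1 F Y)"
    and fun2_id2: "X \<in> Ob1 C \<Longrightarrow> fun2 F (id2 C X) = id2 D (fun1 F X)"
    and fun2_vcomp: "\<lbrakk>f \<in> cells2 C X Y; g \<in> cells2 C Y Z\<rbrakk>
      \<Longrightarrow> fun2 F (g \<cdot>\<^bsub>C\<^esub> f) = fun2 F g \<cdot>\<^bsub>D\<^esub> fun2 F f"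
    and fun2_add: "\<lbrakk>f \<in> cells2 C X Y; g \<in> cells2 C X Y\<rbrakk>
      \<Longrightarrow> fun2 F (add2 C f g) = add2 D (fun2 F f) (fun2 F g)"
    and fun2_scale: "f \<in> cells2 C X Y \<Longrightarrow> fun2 F (scale2 C z f) = scale2 D z (fun2 F f)"
    and fun2_star: "f \<in> cells2 C X Y \<Longrightarrow> fun2 F (star2 C f) = star2 D (fun2 F f)"
    and funmu_unitary: "\<lbrakk>X \<in> cells1 C a b; Y \<in> cells1 C c a\<rbrakk>
      \<Longrightarrow> unitary2 D (fun1 F X \<boxdot>\<^bsub>D\<^esub> fun1 F Y) (fun1 F (X \<boxdot>\<^bsub>C\<^esub> Y)) (funmu F X Y)"
    and funeta_unitary: "a \<in> Ob0 C
      \<Longrightarrow> unitary2 D (id1 D (fun0 F a)) (fun1 F (id1 C a)) (funeta F a)"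
    and funmu_natural: "\<lbrakk>X \<in> cells1 C a b; Y \<in> cells1 C c a; f \<in> cells2 C X X'; g \<in> cells2 C Y Y'\<rbrakk>
      \<Longrightarrow> fun2 F (f \<boxtimes>\<^bsub>C\<^esub> g) \<cdot>\<^bsub>D\<^esub> funmu F X Y = funmu F X' Y' \<cdot>\<^bsub>D\<^esub> (fun2 F f \<boxtimes>\<^bsub>D\<^esub> fun2 F g)"
    and funmu_assoc: "\<lbrakk>X \<in> cells1 C a b; Y \<in> cells1 C c a; Z \<in> cells1 C d c\<rbrakk>
      \<Longrightarrow> funmu F (X \<boxdot>\<^bsub>C\<^esub> Y) Z \<cdot>\<^bsub>D\<^esub> (funmu F X Y \<boxtimes>\<^bsub>D\<^esub> id2 D (fun1 F Z))
        = funmu F X (Y \<boxdot>\<^bsub>C\<^esub> Z) \<cdot>\<^bsub>D\<^esub> (id2 D (fun1 F X) \<boxtimes>\<^bsub>D\<^esub> funmu F Y Z)"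
    and funmu_unit_left: "X \<in> cells1 C a b
      \<Longrightarrow> funmu F (id1 C b) X \<cdot>\<^bsub>D\<^esub> (funeta F b \<boxtimes>\<^bsub>D\<^esub> id2 D (fun1 F X)) = id2 D (fun1 F X)"
    and funmu_unit_right: "X \<in> cells1 C a b
      \<Longrightarrow> funmu F X (id1 C a) \<cdot>\<^bsub>D\<^esub> (id2 D (fun1 F X) \<boxtimes>\<^bsub>D\<^esub> funeta F a) = id2 D (fun1 F X)"

text \<open>A *-2-transformation $\phi : F \Rightarrow G$: \<open>t0 a\<close> is the 1-cell $\phi_a$ and \<open>t1 X\<close> the
  unitary 2-cell $\phi_X$.\<close>

locale star_2_transformation = F: star_2_functor C D F + G: star_2_functor C D G
  for C :: "('o, 'm, 'c) two_cat" and D :: "('p, 'n, 'd) two_cat"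
    and F :: "('o, 'm, 'c, 'p, 'n, 'd) two_functor"
    and G :: "('o, 'm, 'c, 'p, 'n, 'd) two_functor" +
  fixes t0 :: "'o \<Rightarrow> 'n" and t1 :: "'m \<Rightarrow> 'd"
  assumes t0_in: "a \<in> Ob0 C \<Longrightarrow> t0 a \<in> cells1 D (fun0 F a) (fun0 G a)"
    and t1_unitary: "X \<in> cells1 C a b
      \<Longrightarrow> unitary2 D (t0 b \<boxdot>\<^bsub>D\<^esub> fun1 F X) (fun1 G X \<boxdot>\<^bsub>D\<^esub> t0 a) (t1 X)"
    and t1_hcomp: "\<lbrakk>X \<in> cells1 C a b; Y \<in> cells1 C c a\<rbrakk>
      \<Longrightarrow> (funmu G X Y \<boxtimes>\<^bsub>D\<^esub> id2 D (t0 c))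
            \<cdot>\<^bsub>D\<^esub> (id2 D (fun1 G X) \<boxtimes>\<^bsub>D\<^esub> t1 Y) \<cdot>\<^bsub>D\<^esub> (t1 X \<boxtimes>\<^bsub>D\<^esub> id2 D (fun1 F Y))
        = t1 (X \<boxdot>\<^bsub>C\<^esub> Y) \<cdot>\<^bsub>D\<^esub> (id2 D (t0 b) \<boxtimes>\<^bsub>D\<^esub> funmu F X Y)"
    and t1_natural: "\<lbrakk>X \<in> cells1 C a b; f \<in> cells2 C X Y\<rbrakk>
      \<Longrightarrow> (fun2 G f \<boxtimes>\<^bsub>D\<^esub> id2 D (t0 a)) \<cdot>\<^bsub>D\<^esub> t1 X = t1 Y \<cdot>\<^bsub>D\<^esub> (id2 D (t0 b) \<boxtimes>\<^bsub>D\<^esub> fun2 F f)"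
    and t1_unit: "a \<in> Ob0 C
      \<Longrightarrow> funeta G a \<boxtimes>\<^bsub>D\<^esub> id2 D (t0 a) = t1 (id1 C a) \<cdot>\<^bsub>D\<^esub> (id2 D (t0 a) \<boxtimes>\<^bsub>D\<^esub> funeta F a)"

locale star_2_modification =
  S: star_2_transformation C D F G s0 s1 + T: star_2_transformation C D F G t0 t1
  for C :: "('o, 'm, 'c) two_cat" and D :: "('p, 'n, 'd) two_cat"
    and F :: "('o, 'm, 'c, 'p, 'n, 'd) two_functor"
    and G :: "('o, 'm, 'c, 'p, 'n, 'd) two_functor"
    and s0 s1 t0 t1 +
  fixes n :: "'o \<Rightarrow> 'd"
  assumes mod_in: "a \<in> Ob0 C \<Longrightarrow> n a \<in> cells2 D (s0 a) (t0 a)"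
    and mod_bounded: "bdd_above ((\<lambda>a. norm2 D (n a)) ` Ob0 C)"
    and mod_natural: "X \<in> cells1 C a b
      \<Longrightarrow> t1 X \<cdot>\<^bsub>D\<^esub> (n b \<boxtimes>\<^bsub>D\<^esub> id2 D (fun1 F X)) = (id2 D (fun1 G X) \<boxtimes>\<^bsub>D\<^esub> n a) \<cdot>\<^bsub>D\<^esub> s1 X"


section \<open>The 2-category of *-2-functors\<close>

text \<open>Families indexed by the cells of \<open>C\<close> are functions on the whole type that are
  \<^const>\<open>undefined\<close> away from those cells, so that equality of cells of \<open>fun_2cat C D\<close> is equality
  of families. Transformations and modifications record their source and target.\<close>

record ('o, 'm, 'c, 'p, 'n, 'd) transf =
  tr_src :: "('o, 'm, 'c, 'p, 'n, 'd) two_functor"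
  tr_tgt :: "('o, 'm, 'c, 'p, 'n, 'd) two_functor"
  tr0 :: "'o \<Rightarrow> 'n"
  tr1 :: "'m \<Rightarrow> 'd"

record ('o, 'm, 'c, 'p, 'n, 'd) modif =
  md_src :: "('o, 'm, 'c, 'p, 'n, 'd) transf"
  md_tgt :: "('o, 'm, 'c, 'p, 'n, 'd) transf"
  md :: "'o \<Rightarrow> 'd"

definition functors ::
  "('o, 'm, 'c) two_cat \<Rightarrow> ('p, 'n, 'd) two_cat \<Rightarrow> ('o, 'm, 'c, 'p, 'n, 'd) two_functor set" where
  "functors C D = {F. star_2_functor C D F \<and>
     fun0 F \<in> extensional (Ob0 C) \<and> fun1 F \<in> extensional (Ob1 C) \<and>
     fun2 F \<in> extensional (Ob2 C) \<and> funeta F \<in> extensional (Ob0 C) \<and>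
     (\<forall>X Y. \<not> (X \<in> Ob1 C \<and> Y \<in> Ob1 C \<and> src1 C X = tgt1 C Y) \<longrightarrow> funmu F X Y = undefined)}"

definition transformations ::
  "('o, 'm, 'c) two_cat \<Rightarrow> ('p, 'n, 'd) two_cat \<Rightarrow> ('o, 'm, 'c, 'p, 'n, 'd) transf set" where
  "transformations C D = {t. tr_src t \<in> functors C D \<and> tr_tgt t \<in> functors C D \<and>
     star_2_transformation C D (tr_src t) (tr_tgt t) (tr0 t) (tr1 t) \<and>
     tr0 t \<in> extensional (Ob0 C) \<and> tr1 t \<in> extensional (Ob1 C)}"

definition modifications ::
  "('o, 'm, 'c) two_cat \<Rightarrow> ('p, 'n, 'd) two_cat \<Rightarrow> ('o, 'm, 'c, 'p, 'n, 'd) modif set" where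
  "modifications C D = {n. md_src n \<in> transformations C D \<and> md_tgt n \<in> transformations C D \<and>
     tr_src (md_src n) = tr_src (md_tgt n) \<and> tr_tgt (md_src n) = tr_tgt (md_tgt n) \<and>
     star_2_modification C D (tr_src (md_src n)) (tr_tgt (md_src n))
       (tr0 (md_src n)) (tr1 (md_src n)) (tr0 (md_tgt n)) (tr1 (md_tgt n)) (md n) \<and>
     md n \<in> extensional (Ob0 C)}"

definition transf_id ::
  "('o, 'm, 'c) two_cat \<Rightarrow> ('p, 'n, 'd) two_cat \<Rightarrow> ('o, 'm, 'c, 'p, 'n, 'd) two_functor
    \<Rightarrow> ('o, 'm, 'c, 'p, 'n, 'd) transf" where
  "transf_id C D F = \<lparr>tr_src = F, tr_tgt = F,
     tr0 = (\<lambda>a\<in>Ob0 C. id1 D (fun0 F a)), tr1 = (\<lambda>X\<in>Ob1 C. id2 D (fun1 F X))\<rparr>"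

definition transf_comp ::
  "('o, 'm, 'c) two_cat \<Rightarrow> ('p, 'n, 'd) two_cat \<Rightarrow> ('o, 'm, 'c, 'p, 'n, 'd) transf
    \<Rightarrow> ('o, 'm, 'c, 'p, 'n, 'd) transf \<Rightarrow> ('o, 'm, 'c, 'p, 'n, 'd) transf" where
  "transf_comp C D t s = \<lparr>tr_src = tr_src s, tr_tgt = tr_tgt t,
     tr0 = (\<lambda>a\<in>Ob0 C. tr0 t a \<boxdot>\<^bsub>D\<^esub> tr0 s a),
     tr1 = (\<lambda>X\<in>Ob1 C. (tr1 t X \<boxtimes>\<^bsub>D\<^esub> id2 D (tr0 s (src1 C X)))
                        \<cdot>\<^bsub>D\<^esub> (id2 D (tr0 t (tgt1 C X)) \<boxtimes>\<^bsub>D\<^esub> tr1 s X))\<rparr>"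

text \<open>The element \<open>0\<close> is inserted in the supremum defining the norm only for the case
  \<open>Ob0 C = {}\<close>.\<close>

definition fun_2cat ::
  "('o, 'm, 'c) two_cat \<Rightarrow> ('p, 'n, 'd) two_cat \<Rightarrow>
    (('o, 'm, 'c, 'p, 'n, 'd) two_functor, ('o, 'm, 'c, 'p, 'n, 'd) transf,
     ('o, 'm, 'c, 'p, 'n, 'd) modif) two_cat" where
  "fun_2cat C D = \<lparr>
     Ob0 = functors C D,
     Ob1 = transformations C D,
     Ob2 = modifications C D,
     src1 = tr_src,
     tgt1 = tr_tgt,
     src2 = md_src,
     tgt2 = md_tgt,
     id1 = transf_id C D,
     id2 = (\<lambda>t. \<lparr>md_src = t, md_tgt = t, md = (\<lambda>a\<in>Ob0 C. id2 D (tr0 t a))\<rparr>),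
     hcomp1 = transf_comp C D,
     hcomp2 = (\<lambda>n k. \<lparr>md_src = transf_comp C D (md_src n) (md_src k),
                      md_tgt = transf_comp C D (md_tgt n) (md_tgt k),
                      md = (\<lambda>a\<in>Ob0 C. md n a \<boxtimes>\<^bsub>D\<^esub> md k a)\<rparr>),
     vcomp = (\<lambda>n k. \<lparr>md_src = md_src k, md_tgt = md_tgt n,
                     md = (\<lambda>a\<in>Ob0 C. md n a \<cdot>\<^bsub>D\<^esub> md k a)\<rparr>),
     zero2 = (\<lambda>s t. \<lparr>md_src = s, md_tgt = t,
                     md = (\<lambda>a\<in>Ob0 C. zero2 D (tr0 s a) (tr0 t a))\<rparr>),
     add2 = (\<lambda>n k. \<lparr>md_src = md_src n, md_tgt = md_tgt n,
                    md = (\<lambda>a\<in>Ob0 C. add2 D (md n a) (md k a))\<rparr>),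
     scale2 = (\<lambda>z n. \<lparr>md_src = md_src n, md_tgt = md_tgt n,
                      md = (\<lambda>a\<in>Ob0 C. scale2 D z (md n a))\<rparr>),
     star2 = (\<lambda>n. \<lparr>md_src = md_tgt n, md_tgt = md_src n,
                   md = (\<lambda>a\<in>Ob0 C. star2 D (md n a))\<rparr>),
     norm2 = (\<lambda>n. Sup (insert 0 ((\<lambda>a. norm2 D (md n a)) ` Ob0 C)))\<rparr>"

end

theory Submission
  imports Defs
begin

text \<open>Let \<open>\<phi> : F \<Rightarrow> F\<close> be a Q-system of *-2-functors. Every \<open>\<phi>\<^sub>a\<close> is a Q-system in \<open>D\<close> and splits there,
  say \<open>\<phi>\<^sub>a \<cong> x\<^sub>a \<boxdot> x'\<^sub>a\<close>. For \<open>X\<close> from \<open>a\<close> to \<open>b\<close> the 2-cell \<open>\<phi>\<^sub>X\<close> makes \<open>F X \<boxdot> x\<^sub>a\<close> a module over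
  \<open>x\<^sub>b \<boxdot> x'\<^sub>b\<close>, and splitting a projection on \<open>x'\<^sub>b \<boxdot> F X \<boxdot> x\<^sub>a\<close> yields a 1-cell \<open>G X\<close> and a
  unitary module map \<open>\<xi>\<^sub>X\<close> from \<open>x\<^sub>b \<boxdot> G X\<close> to \<open>F X \<boxdot> x\<^sub>a\<close>. Whiskering by \<open>x\<^sub>b\<close> is faithful, and its image
  consists of the module maps between free modules. Hence the 2-cells completing \<open>G\<close> to a functor, and
  the transformation \<open>x'\<close>, are the unique solutions of the equations saying that \<open>\<xi>\<close> is a
  transformation and that \<open>\<phi> \<cong> x \<otimes> x'\<close>; all coherence laws follow from those of \<open>F\<close> and
  \<open>\<phi>\<close> by faithfulness.\<close>

section \<open>Whiskering calculus\<close>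

text \<open>The priorities mirror the normal form used by the simplifier:
  \<open>X \<rhd> f \<lhd> Y\<close> parses as \<open>X \<rhd> (f \<lhd> Y)\<close>, left whiskers
  nest to the right and right whiskers to the left. As abbreviations, both remain horizontal
  composites, so the laws of \<open>\<boxtimes>\<close> apply directly.\<close>

abbreviation left_whisker :: "('o, 'm, 'c) two_cat \<Rightarrow> 'm \<Rightarrow> 'c \<Rightarrow> 'c"  (infixr "\<rhd>\<index>" 76) where
  "X \<rhd>\<^bsub>C\<^esub> f \<equiv> id2 C X \<boxtimes>\<^bsub>C\<^esub> f"

abbreviation right_whisker :: "('o, 'm, 'c) two_cat \<Rightarrow> 'c \<Rightarrow> 'm \<Rightarrow> 'c"  (infixl "\<lhd>\<index>" 77) where
  "f \<lhd>\<^bsub>C\<^esub> X \<equiv> f \<boxtimes>\<^bsub>C\<^esub> id2 C X"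

lemma mem_cells1: "X \<in> cells1 C a b \<longleftrightarrow> X \<in> Ob1 C \<and> src1 C X = a \<and> tgt1 C X = b"
  by (simp add: cells1_def)

lemma mem_cells2: "f \<in> cells2 C X Y \<longleftrightarrow> f \<in> Ob2 C \<and> src2 C f = X \<and> tgt2 C f = Y"
  by (simp add: cells2_def)

context strict_2category
begin

text \<open>The axioms use memberships in \<open>cells1\<close> and \<open>cells2\<close>, whose
  parameters the simplifier would have to guess. From here on typing is expressed by equations for
  \<open>src1\<close>, \<open>tgt1\<close>, \<open>src2\<close> and \<open>tgt2\<close>, which it
  can compute.\<close>

lemma Ob0_cells [simp]:
  "X \<in> Ob1 C \<Longrightarrow> src1 C X \<in> Ob0 C"
  "X \<in> Ob1 C \<Longrightarrow> tgt1 C X \<in> Ob0 C"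
  by (fact src1_in tgt1_in)+

lemma Ob1_cells [simp]:
  "f \<in> Ob2 C \<Longrightarrow> src2 C f \<in> Ob1 C"
  "f \<in> Ob2 C \<Longrightarrow> tgt2 C f \<in> Ob1 C"
  by (fact src2_in tgt2_in)+

text \<open>Oriented towards the source, so that each boundary 0-cell of a 2-cell has one canonical
  expression.\<close>

lemma parallel [simp]:
  "f \<in> Ob2 C \<Longrightarrow> src1 C (tgt2 C f) = src1 C (src2 C f)"
  "f \<in> Ob2 C \<Longrightarrow> tgt1 C (tgt2 C f) = tgt1 C (src2 C f)"
  by (simp_all add: src1_parallel tgt1_parallel)

lemma id1_type [simp]:
  assumes "a \<in> Ob0 C"
  shows "id1 C a \<in> Ob1 C" "src1 C (id1 C a) = a" "tgt1 C (id1 C a) = a"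
  using id1_in[OF assms] by (simp_all add: mem_cells1)

lemma hcomp1_type [simp]:
  assumes "X \<in> Ob1 C" "Y \<in> Ob1 C" "src1 C Y = tgt1 C X"
  shows "Y \<boxdot> X \<in> Ob1 C" "src1 C (Y \<boxdot> X) = src1 C X" "tgt1 C (Y \<boxdot> X) = tgt1 C Y"
  using hcomp1_in[of X _ _ Y] assms by (auto simp: mem_cells1)

lemma hcomp1_assoc' [simp]:
  assumes "X \<in> Ob1 C" "Y \<in> Ob1 C" "Z \<in> Ob1 C" "src1 C Y = tgt1 C X" "src1 C Z = tgt1 C Y"
  shows "(Z \<boxdot> Y) \<boxdot> X = Z \<boxdot> (Y \<boxdot> X)"
  using hcomp1_assoc[of X _ _ Y _ Z] assms by (auto simp: mem_cells1)

lemma hcomp1_id [simp]: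
  "X \<in> Ob1 C \<Longrightarrow> tgt1 C X = b \<Longrightarrow> id1 C b \<boxdot> X = X"
  "X \<in> Ob1 C \<Longrightarrow> src1 C X = a \<Longrightarrow> X \<boxdot> id1 C a = X"
  using hcomp1_id1_left hcomp1_id1_right by (auto simp: mem_cells1)

lemma id2_type [simp]:
  assumes "X \<in> Ob1 C"
  shows "id2 C X \<in> Ob2 C" "src2 C (id2 C X) = X" "tgt2 C (id2 C X) = X"
  using id2_in[OF assms] by (simp_all add: mem_cells2)

lemma vcomp_type [simp]:
  assumes "f \<in> Ob2 C" "g \<in> Ob2 C" "src2 C g = tgt2 C f"
  shows "g \<cdot> f \<in> Ob2 C" "src2 C (g \<cdot> f) = src2 C f" "tgt2 C (g \<cdot> f) = tgt2 C g"
  using vcomp_in[of f _ _ g] assms by (auto simp: mem_cells2)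

lemma vcomp_assoc' [simp]:
  assumes "f \<in> Ob2 C" "g \<in> Ob2 C" "h \<in> Ob2 C" "src2 C g = tgt2 C f" "src2 C h = tgt2 C g"
  shows "(h \<cdot> g) \<cdot> f = h \<cdot> (g \<cdot> f)"
  using vcomp_assoc[of f _ _ g _ h] assms by (auto simp: mem_cells2)

lemma vcomp_id [simp]:
  "f \<in> Ob2 C \<Longrightarrow> tgt2 C f = Y \<Longrightarrow> id2 C Y \<cdot> f = f"
  "f \<in> Ob2 C \<Longrightarrow> src2 C f = X \<Longrightarrow> f \<cdot> id2 C X = f"
  using vcomp_id2_left vcomp_id2_right by (auto simp: mem_cells2)

lemma hcomp2_type [simp]:
  assumes "f \<in> Ob2 C" "g \<in> Ob2 C" "src1 C (src2 C g) = tgt1 C (src2 C f)"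
  shows "g \<boxtimes> f \<in> Ob2 C" "src2 C (g \<boxtimes> f) = src2 C g \<boxdot> src2 C f"
    "tgt2 C (g \<boxtimes> f) = tgt2 C g \<boxdot> tgt2 C f"
  using hcomp2_in[of "src2 C f" _ _ "src2 C g" _ f _ g] assms by (auto simp: mem_cells1 mem_cells2)

lemma hcomp2_assoc':
  assumes "f \<in> Ob2 C" "g \<in> Ob2 C" "h \<in> Ob2 C"
    "src1 C (src2 C g) = tgt1 C (src2 C f)" "src1 C (src2 C h) = tgt1 C (src2 C g)"
  shows "(h \<boxtimes> g) \<boxtimes> f = h \<boxtimes> (g \<boxtimes> f)"
  using hcomp2_assoc[of "src2 C f" _ _ "src2 C g" _ "src2 C h" _ f _ g _ h] assms
  by (auto simp: mem_cells1 mem_cells2)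

lemma hcomp2_id2' [simp]:
  "X \<in> Ob1 C \<Longrightarrow> Y \<in> Ob1 C \<Longrightarrow> src1 C Y = tgt1 C X \<Longrightarrow> id2 C Y \<boxtimes> id2 C X = id2 C (Y \<boxdot> X)"
  using hcomp2_id2 by (auto simp: mem_cells1)

text \<open>Of the associativity of \<open>\<boxtimes>\<close>, only these whiskered instances are
  simplification rules: they split composite whiskers and push right whiskers inside left
  ones.\<close>

lemma whisker_hcomp1 [simp]:
  "\<lbrakk>f \<in> Ob2 C; X \<in> Ob1 C; Y \<in> Ob1 C; src1 C Y = tgt1 C X; src1 C X = tgt1 C (src2 C f)\<rbrakk>
    \<Longrightarrow> (Y \<boxdot> X) \<rhd> f = Y \<rhd> (X \<rhd> f)"
  "\<lbrakk>f \<in> Ob2 C; X \<in> Ob1 C; Y \<in> Ob1 C; src1 C Y = tgt1 C X; tgt1 C Y = src1 C (src2 C f)\<rbrakk>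
    \<Longrightarrow> f \<lhd> (Y \<boxdot> X) = (f \<lhd> Y) \<lhd> X"
  "\<lbrakk>f \<in> Ob2 C; X \<in> Ob1 C; Y \<in> Ob1 C; src1 C Y = tgt1 C (src2 C f); tgt1 C X = src1 C (src2 C f)\<rbrakk>
    \<Longrightarrow> (Y \<rhd> f) \<lhd> X = Y \<rhd> (f \<lhd> X)"
  by (simp_all flip: hcomp2_id2' add: hcomp2_assoc')

lemma whisker_id1 [simp]:
  "f \<in> Ob2 C \<Longrightarrow> tgt1 C (src2 C f) = b \<Longrightarrow> id1 C b \<rhd> f = f"
  "f \<in> Ob2 C \<Longrightarrow> src1 C (src2 C f) = a \<Longrightarrow> f \<lhd> id1 C a = f"
  using hcomp2_id_left[of "src2 C f" _ b f] hcomp2_id_right[of "src2 C f" a _ f]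
  by (auto simp: mem_cells1 mem_cells2)

lemma interchange':
  assumes "f \<in> Ob2 C" "f' \<in> Ob2 C" "g \<in> Ob2 C" "g' \<in> Ob2 C"
    "src2 C f' = tgt2 C f" "src2 C g' = tgt2 C g" "src1 C (src2 C g) = tgt1 C (src2 C f)"
  shows "(g' \<cdot> g) \<boxtimes> (f' \<cdot> f) = (g' \<boxtimes> f') \<cdot> (g \<boxtimes> f)"
  using interchange[of "src2 C f" _ _ "src2 C g" _ f _ f' _ g _ g'] assms
  by (auto simp: mem_cells1 mem_cells2)

lemma whisker_vcomp [simp]:
  "\<lbrakk>f \<in> Ob2 C; g \<in> Ob2 C; src2 C g = tgt2 C f; X \<in> Ob1 C; src1 C X = tgt1 C (src2 C f)\<rbrakk>
    \<Longrightarrow> X \<rhd> (g \<cdot> f) = (X \<rhd> g) \<cdot> (X \<rhd> f)"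
  "\<lbrakk>f \<in> Ob2 C; g \<in> Ob2 C; src2 C g = tgt2 C f; X \<in> Ob1 C; tgt1 C X = src1 C (src2 C f)\<rbrakk>
    \<Longrightarrow> (g \<cdot> f) \<lhd> X = (g \<lhd> X) \<cdot> (f \<lhd> X)"
  using interchange'[of f g "id2 C X" "id2 C X"] interchange'[of "id2 C X" "id2 C X" f g]
  by auto

lemma hcomp2_eq:
  assumes "f \<in> Ob2 C" "g \<in> Ob2 C" "src1 C (src2 C g) = tgt1 C (src2 C f)"
  shows "g \<boxtimes> f = (g \<lhd> tgt2 C f) \<cdot> (src2 C g \<rhd> f)"
  using interchange'[of f "id2 C (tgt2 C f)" "id2 C (src2 C g)" g] assms by simp

text \<open>Both sides are \<open>g \<boxtimes> f\<close>, read in the two possible orders. Neither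
  order is preferred: later proofs slide generators past one another in whichever direction is
  needed.\<close>

lemma exchange:
  assumes "f \<in> Ob2 C" "g \<in> Ob2 C" "src1 C (src2 C g) = tgt1 C (src2 C f)"
  shows "(g \<lhd> tgt2 C f) \<cdot> (src2 C g \<rhd> f) = (tgt2 C g \<rhd> f) \<cdot> (g \<lhd> src2 C f)"
  using hcomp2_eq[OF assms] interchange'[of "id2 C (src2 C f)" f g "id2 C (tgt2 C g)"] assms by simp

text \<open>The whiskering laws above are simplification rules: they turn a pasting diagram into a
  right-nested vertical composite of whiskered generators. The exchange law and other equations
  between two adjacent generators are applied inside such a composite through \<open>vcomp_reassoc\<close>.\<close>

lemma vcomp_reassoc:
  assumes "a \<cdot> b = e" "a \<in> Ob2 C" "b \<in> Ob2 C" "k \<in> Ob2 C" "src2 C a = tgt2 C b"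
    "src2 C b = tgt2 C k"
  shows "a \<cdot> (b \<cdot> k) = e \<cdot> k"
  using assms vcomp_assoc'[of k b a] by auto

lemma vcomp_reassoc3:
  assumes "a \<cdot> (b \<cdot> c) = e" "a \<in> Ob2 C" "b \<in> Ob2 C" "c \<in> Ob2 C" "k \<in> Ob2 C"
    "src2 C a = tgt2 C b" "src2 C b = tgt2 C c" "src2 C c = tgt2 C k"
  shows "a \<cdot> (b \<cdot> (c \<cdot> k)) = e \<cdot> k"
  using assms vcomp_assoc'[of k "b \<cdot> c" a] by auto

text \<open>The premise has the shape of the unitarity and coisometry laws, so one-sided inverses
  disappear inside longer composites and under whiskers.\<close>

lemma cancel:
  "\<lbrakk>a \<cdot> b = id2 C (src2 C b); a \<in> Ob2 C; b \<in> Ob2 C; src2 C a = tgt2 C b; k \<in> Ob2 C; src2 C b = tgt2 C k\<rbrakk>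
    \<Longrightarrow> a \<cdot> (b \<cdot> k) = k"
  "\<lbrakk>a \<cdot> b = id2 C (src2 C b); a \<in> Ob2 C; b \<in> Ob2 C; src2 C a = tgt2 C b; X \<in> Ob1 C;
    src1 C X = tgt1 C (src2 C b)\<rbrakk> \<Longrightarrow> (X \<rhd> a) \<cdot> (X \<rhd> b) = id2 C (X \<boxdot> src2 C b)"
  "\<lbrakk>a \<cdot> b = id2 C (src2 C b); a \<in> Ob2 C; b \<in> Ob2 C; src2 C a = tgt2 C b; X \<in> Ob1 C;
    tgt1 C X = src1 C (src2 C b)\<rbrakk> \<Longrightarrow> (a \<lhd> X) \<cdot> (b \<lhd> X) = id2 C (src2 C b \<boxdot> X)"
  using vcomp_reassoc[of a b "id2 C (src2 C b)" k] whisker_vcomp[of b a X, symmetric] by auto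

end

section \<open>Involution, linear structure and norm on 2-cells\<close>

context strict_cstar_2category
begin

lemma star2_type [simp]:
  assumes "f \<in> Ob2 C"
  shows "star2 C f \<in> Ob2 C" "src2 C (star2 C f) = tgt2 C f" "tgt2 C (star2 C f) = src2 C f"
proof -
  interpret H: cstar_category "cells1 C (src1 C (src2 C f)) (tgt1 C (src2 C f))" "cells2 C" "id2 C"
    "vcomp C" "zero2 C" "add2 C" "scale2 C" "star2 C" "norm2 C"
    using assms by (intro hom_cstar_category) auto
  show "star2 C f \<in> Ob2 C" "src2 C (star2 C f) = tgt2 C f" "tgt2 C (star2 C f) = src2 C f"
    using H.star_in[of "src2 C f" "tgt2 C f" f] assms by (auto simp: mem_cells1 mem_cells2)
qed

lemma star2_star2 [simp]:
  assumes "f \<in> Ob2 C"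
  shows "star2 C (star2 C f) = f"
proof -
  interpret H: cstar_category "cells1 C (src1 C (src2 C f)) (tgt1 C (src2 C f))" "cells2 C" "id2 C"
    "vcomp C" "zero2 C" "add2 C" "scale2 C" "star2 C" "norm2 C"
    using assms by (intro hom_cstar_category) auto
  show ?thesis
    using H.star_star[of "src2 C f" "tgt2 C f" f] assms by (auto simp: mem_cells1 mem_cells2)
qed

lemma star2_vcomp [simp]:
  assumes "f \<in> Ob2 C" "g \<in> Ob2 C" "src2 C g = tgt2 C f"
  shows "star2 C (g \<cdot> f) = star2 C f \<cdot> star2 C g"
proof -
  interpret H: cstar_category "cells1 C (src1 C (src2 C f)) (tgt1 C (src2 C f))" "cells2 C" "id2 C"
    "vcomp C" "zero2 C" "add2 C" "scale2 C" "star2 C" "norm2 C"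
    using assms by (intro hom_cstar_category) auto
  have "tgt1 C (tgt2 C g) = tgt1 C (src2 C f)" "src1 C (tgt2 C g) = src1 C (src2 C f)"
    using assms by simp_all
  then show ?thesis
    using H.star_cmp[of "src2 C f" "tgt2 C f" "tgt2 C g" f g] assms
    by (auto simp: mem_cells1 mem_cells2)
qed

text \<open>The cell \<open>id2 C X \<cdot> star2 C (id2 C X)\<close> is self-adjoint and equals
  \<open>star2 C (id2 C X)\<close>; applying the involution once more gives the identity.\<close>

lemma star2_id2 [simp]:
  assumes "X \<in> Ob1 C"
  shows "star2 C (id2 C X) = id2 C X"
  using star2_vcomp[of "star2 C (id2 C X)" "id2 C X"] star2_star2[of "id2 C X"] assms by simp

lemma star2_hcomp2' [simp]:
  assumes "f \<in> Ob2 C" "g \<in> Ob2 C" "src1 C (src2 C g) = tgt1 C (src2 C f)"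
  shows "star2 C (g \<boxtimes> f) = star2 C g \<boxtimes> star2 C f"
  using star2_hcomp2[of "src2 C f" _ _ "src2 C g" _ f _ g] assms by (auto simp: mem_cells1 mem_cells2)

lemma add2_type [simp]:
  assumes "f \<in> Ob2 C" "g \<in> Ob2 C" "src2 C g = src2 C f" "tgt2 C g = tgt2 C f"
  shows "add2 C f g \<in> Ob2 C" "src2 C (add2 C f g) = src2 C f" "tgt2 C (add2 C f g) = tgt2 C f"
proof -
  interpret H: cstar_category "cells1 C (src1 C (src2 C f)) (tgt1 C (src2 C f))" "cells2 C" "id2 C"
    "vcomp C" "zero2 C" "add2 C" "scale2 C" "star2 C" "norm2 C"
    using assms by (intro hom_cstar_category) auto
  interpret B: complex_banach_space_on "cells2 C (src2 C f) (tgt2 C f)"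
    "zero2 C (src2 C f) (tgt2 C f)" "add2 C" "scale2 C" "norm2 C"
    using assms by (intro H.hom_banach) (auto simp: mem_cells1)
  show "add2 C f g \<in> Ob2 C" "src2 C (add2 C f g) = src2 C f" "tgt2 C (add2 C f g) = tgt2 C f"
    using B.add_closed[of f g] assms by (auto simp: mem_cells2)
qed

lemma scale2_type [simp]:
  assumes "f \<in> Ob2 C"
  shows "scale2 C z f \<in> Ob2 C" "src2 C (scale2 C z f) = src2 C f" "tgt2 C (scale2 C z f) = tgt2 C f"
proof -
  interpret H: cstar_category "cells1 C (src1 C (src2 C f)) (tgt1 C (src2 C f))" "cells2 C" "id2 C"
    "vcomp C" "zero2 C" "add2 C" "scale2 C" "star2 C" "norm2 C"
    using assms by (intro hom_cstar_category) auto
  interpret B: complex_banach_space_on "cells2 C (src2 C f) (tgt2 C f)"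
    "zero2 C (src2 C f) (tgt2 C f)" "add2 C" "scale2 C" "norm2 C"
    using assms by (intro H.hom_banach) (auto simp: mem_cells1)
  show "scale2 C z f \<in> Ob2 C" "src2 C (scale2 C z f) = src2 C f" "tgt2 C (scale2 C z f) = tgt2 C f"
    using B.scale_closed[of f z] assms by (auto simp: mem_cells2)
qed

lemma vcomp_linear_right:
  assumes "f \<in> Ob2 C" "h \<in> Ob2 C" "src2 C h = tgt2 C f"
  shows "\<lbrakk>g \<in> Ob2 C; src2 C g = src2 C f; tgt2 C g = tgt2 C f\<rbrakk>
      \<Longrightarrow> h \<cdot> add2 C f g = add2 C (h \<cdot> f) (h \<cdot> g)"
    "h \<cdot> scale2 C z f = scale2 C z (h \<cdot> f)"
proof -
  interpret H: cstar_category "cells1 C (src1 C (src2 C f)) (tgt1 C (src2 C f))" "cells2 C" "id2 C"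
    "vcomp C" "zero2 C" "add2 C" "scale2 C" "star2 C" "norm2 C"
    using assms by (intro hom_cstar_category) auto
  have "tgt1 C (tgt2 C h) = tgt1 C (src2 C f)" "src1 C (tgt2 C h) = src1 C (src2 C f)"
    using assms by simp_all
  then show "\<lbrakk>g \<in> Ob2 C; src2 C g = src2 C f; tgt2 C g = tgt2 C f\<rbrakk>
      \<Longrightarrow> h \<cdot> add2 C f g = add2 C (h \<cdot> f) (h \<cdot> g)"
    "h \<cdot> scale2 C z f = scale2 C z (h \<cdot> f)"
    using assms H.cmp_add_right[of "src2 C f" "tgt2 C f" "tgt2 C h" f g h]
      H.cmp_scale_right[of "src2 C f" "tgt2 C f" "tgt2 C h" f h z]
    by (auto simp: mem_cells1 mem_cells2)
qed

lemma vcomp_linear_left: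
  assumes "f \<in> Ob2 C" "h \<in> Ob2 C" "tgt2 C h = src2 C f"
  shows "\<lbrakk>g \<in> Ob2 C; src2 C g = src2 C f; tgt2 C g = tgt2 C f\<rbrakk>
      \<Longrightarrow> add2 C f g \<cdot> h = add2 C (f \<cdot> h) (g \<cdot> h)"
    "scale2 C z f \<cdot> h = scale2 C z (f \<cdot> h)"
proof -
  interpret H: cstar_category "cells1 C (src1 C (src2 C f)) (tgt1 C (src2 C f))" "cells2 C" "id2 C"
    "vcomp C" "zero2 C" "add2 C" "scale2 C" "star2 C" "norm2 C"
    using assms by (intro hom_cstar_category) auto
  have "tgt1 C (src2 C h) = tgt1 C (src2 C f)" "src1 C (src2 C h) = src1 C (src2 C f)"
    using assms by (metis parallel)+
  then show "\<lbrakk>g \<in> Ob2 C; src2 C g = src2 C f; tgt2 C g = tgt2 C f\<rbrakk>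
      \<Longrightarrow> add2 C f g \<cdot> h = add2 C (f \<cdot> h) (g \<cdot> h)"
    "scale2 C z f \<cdot> h = scale2 C z (f \<cdot> h)"
    using assms H.cmp_add_left[of "src2 C h" "src2 C f" "tgt2 C f" h f g]
      H.cmp_scale_left[of "src2 C h" "src2 C f" "tgt2 C f" h f z]
    by (auto simp: mem_cells1 mem_cells2)
qed

lemma whisker_add:
  assumes "f \<in> Ob2 C" "g \<in> Ob2 C" "src2 C g = src2 C f" "tgt2 C g = tgt2 C f" "X \<in> Ob1 C"
  shows "src1 C X = tgt1 C (src2 C f) \<Longrightarrow> X \<rhd> add2 C f g = add2 C (X \<rhd> f) (X \<rhd> g)"
    "tgt1 C X = src1 C (src2 C f) \<Longrightarrow> add2 C f g \<lhd> X = add2 C (f \<lhd> X) (g \<lhd> X)"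
  using assms hcomp2_add_right[of "src2 C f" _ _ X _ f _ g "id2 C X" X]
    hcomp2_add_left[of X _ _ "src2 C f" _ "id2 C X" X f _ g]
  by (auto simp: mem_cells1 mem_cells2)

lemma whisker_scale:
  assumes "f \<in> Ob2 C" "X \<in> Ob1 C"
  shows "src1 C X = tgt1 C (src2 C f) \<Longrightarrow> X \<rhd> scale2 C z f = scale2 C z (X \<rhd> f)"
    "tgt1 C X = src1 C (src2 C f) \<Longrightarrow> scale2 C z f \<lhd> X = scale2 C z (f \<lhd> X)"
  using assms hcomp2_scale_right[of "src2 C f" _ _ X _ f _ "id2 C X" X z]
    hcomp2_scale_left[of X _ _ "src2 C f" _ "id2 C X" X f _ z]
  by (auto simp: mem_cells1 mem_cells2)

text \<open>By the C*-identity this norm equals its own square. It is 0 when the hom-space is zero,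
  whence only an inequality.\<close>

lemma norm2_id2_le:
  assumes "X \<in> Ob1 C"
  shows "norm2 C (id2 C X) \<le> 1"
proof -
  interpret H: cstar_category "cells1 C (src1 C X) (tgt1 C X)" "cells2 C" "id2 C"
    "vcomp C" "zero2 C" "add2 C" "scale2 C" "star2 C" "norm2 C"
    using assms by (intro hom_cstar_category) auto
  have "norm2 C (id2 C X) = (norm2 C (id2 C X))\<^sup>2"
    using H.cstar_identity[of X X "id2 C X"] assms by (auto simp: mem_cells1 mem_cells2)
  then show ?thesis
    by (metis order_refl power2_eq_square mult_cancel_left2 zero_le_one)
qed

lemma norm2_vcomp_le:
  assumes "f \<in> Ob2 C" "g \<in> Ob2 C" "src2 C g = tgt2 C f"
  shows "norm2 C (g \<cdot> f) \<le> norm2 C g * norm2 C f"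
proof -
  interpret H: cstar_category "cells1 C (src1 C (src2 C f)) (tgt1 C (src2 C f))" "cells2 C" "id2 C"
    "vcomp C" "zero2 C" "add2 C" "scale2 C" "star2 C" "norm2 C"
    using assms by (intro hom_cstar_category) auto
  have "tgt1 C (tgt2 C g) = tgt1 C (src2 C f)" "src1 C (tgt2 C g) = src1 C (src2 C f)"
    using assms by simp_all
  then show ?thesis
    using H.nrm_cmp[of "src2 C f" "tgt2 C f" "tgt2 C g" f g] assms
    by (auto simp: mem_cells1 mem_cells2)
qed

lemma norm2_nonneg:
  assumes "f \<in> Ob2 C"
  shows "0 \<le> norm2 C f"
proof -
  interpret H: cstar_category "cells1 C (src1 C (src2 C f)) (tgt1 C (src2 C f))" "cells2 C" "id2 C"
    "vcomp C" "zero2 C" "add2 C" "scale2 C" "star2 C" "norm2 C"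
    using assms by (intro hom_cstar_category) auto
  interpret B: complex_banach_space_on "cells2 C (src2 C f) (tgt2 C f)"
    "zero2 C (src2 C f) (tgt2 C f)" "add2 C" "scale2 C" "norm2 C"
    using assms by (intro H.hom_banach) (auto simp: mem_cells1)
  show ?thesis
    using B.nrm_nonneg assms by (auto simp: mem_cells2)
qed

text \<open>Together with \<open>norm2_coisometry_le\<close> this gives bounds that do not depend on
  the cell, as the uniform boundedness of a modification requires.\<close>

lemma norm2_isometry_le:
  assumes "f \<in> Ob2 C" "star2 C f \<cdot> f = id2 C (src2 C f)"
  shows "norm2 C f \<le> 1"
proof -
  interpret H: cstar_category "cells1 C (src1 C (src2 C f)) (tgt1 C (src2 C f))" "cells2 C" "id2 C"
    "vcomp C" "zero2 C" "add2 C" "scale2 C" "star2 C" "norm2 C"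
    using assms by (intro hom_cstar_category) auto
  have "(norm2 C f)\<^sup>2 \<le> 1"
    using H.cstar_identity[of "src2 C f" "tgt2 C f" f] norm2_id2_le[of "src2 C f"] assms
    by (auto simp: mem_cells1 mem_cells2)
  then show ?thesis
    by (simp add: norm2_nonneg assms(1) power_le_one_iff)
qed

text \<open>The C*-identity bounds the square of the norm of \<open>f\<close> by the product of the
  norms of its adjoint and of \<open>f\<close>; one factor cancels unless it is 0.\<close>

lemma norm2_star2:
  assumes "f \<in> Ob2 C"
  shows "norm2 C f \<le> norm2 C (star2 C f)"
proof -
  interpret H: cstar_category "cells1 C (src1 C (src2 C f)) (tgt1 C (src2 C f))" "cells2 C" "id2 C"
    "vcomp C" "zero2 C" "add2 C" "scale2 C" "star2 C" "norm2 C"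
    using assms by (intro hom_cstar_category) auto
  have "norm2 C f * norm2 C f \<le> norm2 C (star2 C f) * norm2 C f"
    using H.cstar_identity[of "src2 C f" "tgt2 C f" f] norm2_vcomp_le[of f "star2 C f"] assms
    by (auto simp: mem_cells1 mem_cells2 power2_eq_square)
  then show ?thesis
    using norm2_nonneg[of f] norm2_nonneg[of "star2 C f"] assms
    by (cases "norm2 C f = 0") auto
qed

lemma norm2_coisometry_le:
  assumes "f \<in> Ob2 C" "f \<cdot> star2 C f = id2 C (tgt2 C f)"
  shows "norm2 C f \<le> 1"
  using norm2_star2[of f] norm2_isometry_le[of "star2 C f"] assms by simp

end

section \<open>Modules over a split Q-system\<close>

text \<open>The algebra in question is \<open>x \<boxdot> x'\<close> with multiplication
  \<open>x \<rhd> (ev \<lhd> x')\<close>. A module is a 1-cell \<open>M\<close> ending where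
  \<open>x\<close> ends, with an action from \<open>x \<boxdot> (x' \<boxdot> M)\<close> to
  \<open>M\<close>. Free modules are those of the form \<open>x \<boxdot> Y\<close> with action
  \<open>x \<rhd> (ev \<lhd> Y)\<close>.\<close>

locale separable_dual = strict_cstar_2category D for D :: "('p, 'n, 'd) two_cat" (structure) +
  fixes x x' :: 'n and ev :: 'd
  assumes x [simp]: "x \<in> Ob1 D"
    and x' [simp]: "x' \<in> Ob1 D" "src1 D x' = tgt1 D x" "tgt1 D x' = src1 D x"
    and ev [simp]: "ev \<in> Ob2 D" "src2 D ev = x' \<boxdot> x" "tgt2 D ev = id1 D (src1 D x)"
    and ev_coisometry: "ev \<cdot> star2 D ev = id2 D (id1 D (src1 D x))"
begin

lemma ev_coisometry_whisker [simp]: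
  assumes "S \<in> Ob1 D" "tgt1 D S = src1 D x"
  shows "(ev \<lhd> S) \<cdot> (star2 D ev \<lhd> S) = id2 D S"
proof -
  have "(ev \<cdot> star2 D ev) \<lhd> S = id2 D (id1 D (src1 D x)) \<lhd> S"
    by (simp only: ev_coisometry)
  then show ?thesis using assms by simp
qed

lemma ev_natural:
  assumes "f \<in> Ob2 D" "tgt1 D (src2 D f) = src1 D x"
  shows "(ev \<lhd> tgt2 D f) \<cdot> (x' \<rhd> (x \<rhd> f)) = f \<cdot> (ev \<lhd> src2 D f)"
  using exchange[of f ev] assms by simp

lemma ev_star_natural:
  assumes "f \<in> Ob2 D" "tgt1 D (src2 D f) = src1 D x"
  shows "(x' \<rhd> (x \<rhd> f)) \<cdot> (star2 D ev \<lhd> src2 D f) = (star2 D ev \<lhd> tgt2 D f) \<cdot> f"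
  using exchange[of f "star2 D ev"] assms by simp

text \<open>A cell is recovered from its whiskering: whisker by \<open>x'\<close> as well and
  compress between the adjoint of \<open>ev\<close> and \<open>ev\<close>. The adjoint slides past
  the cell and then cancels against \<open>ev\<close>.\<close>

lemma whisker_faithful:
  assumes "x \<rhd> f = x \<rhd> g" "f \<in> Ob2 D" "g \<in> Ob2 D"
    "tgt1 D (src2 D f) = src1 D x" "src2 D f = src2 D g" "tgt2 D f = tgt2 D g"
  shows "f = g"
proof -
  have recover: "(ev \<lhd> tgt2 D h) \<cdot> ((x' \<rhd> (x \<rhd> h)) \<cdot> (star2 D ev \<lhd> src2 D h)) = h"
    if "h \<in> Ob2 D" "tgt1 D (src2 D h) = src1 D x" for h
    using that ev_star_natural[of h] by (simp add: vcomp_reassoc[OF ev_coisometry_whisker])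
  show ?thesis
    using recover[of f] recover[of g] assms by metis
qed

text \<open>The preimage is the compression that recovers a cell in \<open>whisker_faithful\<close>,
  now applied to \<open>h\<close>. Linearity moves the action past \<open>h\<close>, where it meets
  the adjoint of \<open>ev\<close> and cancels.\<close>

lemma whisker_full:
  assumes [simp]: "h \<in> Ob2 D" "src2 D h = x \<boxdot> Y" "tgt2 D h = x \<boxdot> Z"
      "Y \<in> Ob1 D" "tgt1 D Y = src1 D x" "Z \<in> Ob1 D" "tgt1 D Z = src1 D x"
    and lin: "h \<cdot> (x \<rhd> (ev \<lhd> Y)) = (x \<rhd> (ev \<lhd> Z)) \<cdot> (x \<rhd> (x' \<rhd> h))"
  obtains f where "f \<in> Ob2 D" "src2 D f = Y" "tgt2 D f = Z" "x \<rhd> f = h"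
proof
  have par: "src1 D Y = src1 D Z"
    using parallel(1)[of h] by simp
  let ?f = "(ev \<lhd> Z) \<cdot> ((x' \<rhd> h) \<cdot> (star2 D ev \<lhd> Y))"
  show "?f \<in> Ob2 D" "src2 D ?f = Y" "tgt2 D ?f = Z"
    using par by auto
  \<comment> \<open>This is the coisometry law under \<open>x\<close>. The rule is switched off
    afterwards, since it would collapse the composite before the whisker is distributed over
    it.\<close>
  have "x \<rhd> ((ev \<lhd> Y) \<cdot> (star2 D ev \<lhd> Y)) = x \<rhd> id2 D Y"
    by simp
  then have sep: "(x \<rhd> (ev \<lhd> Y)) \<cdot> (x \<rhd> (star2 D ev \<lhd> Y)) = id2 D (x \<boxdot> Y)"
    by (simp del: ev_coisometry_whisker)
  show "x \<rhd> ?f = h"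
    using par by (simp add: vcomp_reassoc[OF lin[symmetric]] sep)
qed

text \<open>Here \<open>xi\<close> identifies the module \<open>M\<close> with the free module on
  \<open>N'\<close>. A module map \<open>k\<close> from the free module on \<open>N\<close>
  therefore corresponds to a map between free modules, and such a map is a whiskering by
  \<open>whisker_full\<close>.\<close>

lemma factor_module_map:
  assumes [simp]: "N \<in> Ob1 D" "tgt1 D N = src1 D x" "N' \<in> Ob1 D" "tgt1 D N' = src1 D x"
      "xi \<in> Ob2 D" "src2 D xi = x \<boxdot> N'" "tgt2 D xi = M" "star2 D xi \<cdot> xi = id2 D (x \<boxdot> N')"
      and xi_coiso [simp]: "xi \<cdot> star2 D xi = id2 D M"
    and [simp]: "al \<in> Ob2 D" "src2 D al = x \<boxdot> (x' \<boxdot> M)" "tgt2 D al = M"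
      "k \<in> Ob2 D" "src2 D k = x \<boxdot> N" "tgt2 D k = M"
    and xi_lin: "xi \<cdot> (x \<rhd> (ev \<lhd> N')) = al \<cdot> (x \<rhd> (x' \<rhd> xi))"
    and k_lin: "k \<cdot> (x \<rhd> (ev \<lhd> N)) = al \<cdot> (x \<rhd> (x' \<rhd> k))"
  obtains f where "f \<in> Ob2 D" "src2 D f = N" "tgt2 D f = N'" "xi \<cdot> (x \<rhd> f) = k"
proof -
  have M [simp]: "M \<in> Ob1 D" "tgt1 D M = tgt1 D x" "src1 D M = src1 D N'"
    using Ob1_cells[of xi] parallel[of xi] by simp_all
  have par: "src1 D N = src1 D N'"
    using parallel(1)[of k] by simp
  have "x \<rhd> (x' \<rhd> (xi \<cdot> star2 D xi)) = (x \<rhd> (x' \<rhd> xi)) \<cdot> (x \<rhd> (x' \<rhd> star2 D xi))"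
    by (simp del: xi_coiso)
  then have xx: "(x \<rhd> (x' \<rhd> xi)) \<cdot> (x \<rhd> (x' \<rhd> star2 D xi)) = id2 D (x \<boxdot> (x' \<boxdot> M))"
    by simp
  \<comment> \<open>Composing \<open>xi_lin\<close> with the adjoint of \<open>xi\<close> on both
    sides shows that this adjoint is a module map too.\<close>
  have "star2 D xi \<cdot> (al \<cdot> ((x \<rhd> (x' \<rhd> xi)) \<cdot> (x \<rhd> (x' \<rhd> star2 D xi)))) 
      = star2 D xi \<cdot> ((al \<cdot> (x \<rhd> (x' \<rhd> xi))) \<cdot> (x \<rhd> (x' \<rhd> star2 D xi)))"
    by (simp del: hcomp2_id2')
  also have "\<dots> = star2 D xi \<cdot> (xi \<cdot> ((x \<rhd> (ev \<lhd> N')) \<cdot> (x \<rhd> (x' \<rhd> star2 D xi))))"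
    by (simp flip: xi_lin)
  also have "\<dots> = (x \<rhd> (ev \<lhd> N')) \<cdot> (x \<rhd> (x' \<rhd> star2 D xi))"
    using vcomp_reassoc[of "star2 D xi" xi "id2 D (x \<boxdot> N')"] by simp
  finally have a: "star2 D xi \<cdot> al = (x \<rhd> (ev \<lhd> N')) \<cdot> (x \<rhd> (x' \<rhd> star2 D xi))"
    by (simp add: xx)
  have "(star2 D xi \<cdot> k) \<cdot> (x \<rhd> (ev \<lhd> N))
      = (x \<rhd> (ev \<lhd> N')) \<cdot> (x \<rhd> (x' \<rhd> (star2 D xi \<cdot> k)))"
    using par by (simp add: k_lin vcomp_reassoc[OF a])
  then obtain f where f: "f \<in> Ob2 D" "src2 D f = N" "tgt2 D f = N'" "x \<rhd> f = star2 D xi \<cdot> k"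
    using par by (elim whisker_full[rotated -1]) simp_all
  then have "xi \<cdot> (x \<rhd> f) = k"
    using par vcomp_reassoc[of xi "star2 D xi" "id2 D M" k] by simp
  then show ?thesis using that f by blast
qed

lemma factor_unique:
  assumes eq: "xi \<cdot> (x \<rhd> f) = xi \<cdot> (x \<rhd> g)"
    and [simp]: "f \<in> Ob2 D" "g \<in> Ob2 D" "tgt1 D (src2 D f) = src1 D x"
      "src2 D g = src2 D f" "tgt2 D g = tgt2 D f" "xi \<in> Ob2 D"
      "src2 D xi = x \<boxdot> tgt2 D f" "star2 D xi \<cdot> xi = id2 D (x \<boxdot> tgt2 D f)"
  shows "f = g"
proof (rule whisker_faithful)
  have "star2 D xi \<cdot> (xi \<cdot> (x \<rhd> f)) = star2 D xi \<cdot> (xi \<cdot> (x \<rhd> g))"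
    by (simp only: eq)
  then show "x \<rhd> f = x \<rhd> g"
    by (simp add: cancel)
qed simp_all

text \<open>The whiskering of \<open>f\<close> is the composite of two unitaries, the adjoint of
  \<open>xi\<close> and \<open>k\<close>; faithfulness reflects the unitarity equations.\<close>

lemma factor_unitary:
  assumes [simp]: "f \<in> Ob2 D" "tgt1 D (src2 D f) = src1 D x" "xi \<in> Ob2 D"
      "src2 D xi = x \<boxdot> tgt2 D f"
      "star2 D xi \<cdot> xi = id2 D (x \<boxdot> tgt2 D f)" "xi \<cdot> star2 D xi = id2 D (tgt2 D xi)"
    and k: "xi \<cdot> (x \<rhd> f) = k" "star2 D k \<cdot> k = id2 D (src2 D k)" "k \<cdot> star2 D k = id2 D (tgt2 D k)"
  shows "star2 D f \<cdot> f = id2 D (src2 D f)" "f \<cdot> star2 D f = id2 D (tgt2 D f)"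
proof -
  have k_type [simp]: "k \<in> Ob2 D" "src2 D k = x \<boxdot> src2 D f" "tgt2 D k = tgt2 D xi"
    unfolding k(1)[symmetric] by simp_all
  have f: "x \<rhd> f = star2 D xi \<cdot> k"
    unfolding k(1)[symmetric] using vcomp_reassoc[of "star2 D xi" xi "id2 D (x \<boxdot> tgt2 D f)"] by simp
  have "star2 D (x \<rhd> f) = star2 D (star2 D xi \<cdot> k)"
    by (simp only: f)
  then have f': "x \<rhd> star2 D f = star2 D k \<cdot> xi"
    by simp
  show "star2 D f \<cdot> f = id2 D (src2 D f)"
    by (rule whisker_faithful)
      (simp_all add: f f' k vcomp_reassoc[of xi "star2 D xi" "id2 D (tgt2 D xi)"])
  show "f \<cdot> star2 D f = id2 D (tgt2 D f)"
    by (rule whisker_faithful)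
      (simp_all add: f f' vcomp_reassoc[OF k(3)])
qed

text \<open>The adjoint of \<open>al\<close> embeds \<open>M\<close> into the free module on
  \<open>x' \<boxdot> M\<close>. By \<open>frob\<close> its range projection is the whiskering of
  the cell \<open>p\<close> on \<open>x' \<boxdot> M\<close>, so \<open>p\<close> is a projection by
  faithfulness. If \<open>v\<close> splits \<open>p\<close> with domain \<open>N\<close>, then
  \<open>al\<close> restricted along \<open>x \<rhd> v\<close> identifies the free module on
  \<open>N\<close> with \<open>M\<close>.\<close>

lemma module_splits:
  assumes complete: "locally_projection_complete D"
    and [simp]: "M \<in> Ob1 D" "tgt1 D M = tgt1 D x"
      "al \<in> Ob2 D" "src2 D al = x \<boxdot> (x' \<boxdot> M)" "tgt2 D al = M"
    and assoc: "al \<cdot> (x \<rhd> (ev \<lhd> x' \<lhd> M)) = al \<cdot> (x \<rhd> (x' \<rhd> al))"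
    and coiso: "al \<cdot> star2 D al = id2 D M"
    and frob: "star2 D al \<cdot> al = (x \<rhd> (x' \<rhd> al)) \<cdot> (x \<rhd> (star2 D ev \<lhd> x' \<lhd> M))"
  obtains N xi where "N \<in> Ob1 D" "src1 D N = src1 D M" "tgt1 D N = src1 D x"
    "xi \<in> Ob2 D" "src2 D xi = x \<boxdot> N" "tgt2 D xi = M"
    "star2 D xi \<cdot> xi = id2 D (x \<boxdot> N)" "xi \<cdot> star2 D xi = id2 D M"
    "xi \<cdot> (x \<rhd> (ev \<lhd> N)) = al \<cdot> (x \<rhd> (x' \<rhd> xi))"
proof -
  define p where "p = (x' \<rhd> al) \<cdot> (star2 D ev \<lhd> x' \<lhd> M)"
  have p [simp]: "p \<in> Ob2 D" "src2 D p = x' \<boxdot> M" "tgt2 D p = x' \<boxdot> M"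
    by (simp_all add: p_def)
  have xp: "x \<rhd> p = star2 D al \<cdot> al"
    by (simp add: p_def frob)
  have "star2 D (x \<rhd> p) = star2 D (star2 D al \<cdot> al)"
    by (simp only: xp)
  then have "x \<rhd> star2 D p = star2 D al \<cdot> al"
    by simp
  then have "star2 D p = p"
    using xp by (auto intro: whisker_faithful)
  moreover have "p \<cdot> p = p"
    by (rule whisker_faithful) (simp_all add: xp vcomp_reassoc[OF coiso])
  ultimately have "projection2 D (x' \<boxdot> M) p"
    by (simp add: projection2_def mem_cells2)
  moreover have "x' \<boxdot> M \<in> cells1 D (src1 D M) (src1 D x)"
    by (simp add: mem_cells1)
  ultimately obtain N v where "N \<in> cells1 D (src1 D M) (src1 D x)" "isometry2 D N (x' \<boxdot> M) v"
    and vv: "v \<cdot> star2 D v = p"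
    using complete unfolding locally_projection_complete_def by meson
  then have [simp]: "N \<in> Ob1 D" "src1 D N = src1 D M" "tgt1 D N = src1 D x"
      "v \<in> Ob2 D" "src2 D v = N" "tgt2 D v = x' \<boxdot> M"
    and iso: "star2 D v \<cdot> v = id2 D N"
    by (auto simp: mem_cells1 mem_cells2 isometry2_def)
  have "x \<rhd> (v \<cdot> star2 D v) = star2 D al \<cdot> al"
    by (simp only: vv xp)
  then have xvv: "(x \<rhd> v) \<cdot> (x \<rhd> star2 D v) = star2 D al \<cdot> al"
    by simp
  have "x \<rhd> (star2 D v \<cdot> v) = id2 D (x \<boxdot> N)"
    by (simp only: iso) simp
  then have xiso: "(x \<rhd> star2 D v) \<cdot> (x \<rhd> v) = id2 D (x \<boxdot> N)"
    by simp
  let ?xi = "al \<cdot> (x \<rhd> v)"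
  show ?thesis
  proof
    show "?xi \<in> Ob2 D" "src2 D ?xi = x \<boxdot> N" "tgt2 D ?xi = M"
      by simp_all
    show "?xi \<cdot> star2 D ?xi = id2 D M"
      by (simp add: vcomp_reassoc[OF xvv] vcomp_reassoc[OF coiso] coiso)
    show "star2 D ?xi \<cdot> ?xi = id2 D (x \<boxdot> N)"
      by (simp add: vcomp_reassoc[OF xvv[symmetric]] vcomp_reassoc[OF xiso] xiso)
    \<comment> \<open>Naturality of \<open>ev\<close> makes \<open>x \<rhd> v\<close> a map of free
      modules. By \<open>assoc\<close> the action \<open>al\<close> is itself a module map, so their
      composite is linear.\<close>
    have "x \<rhd> ((ev \<lhd> tgt2 D v) \<cdot> (x' \<rhd> (x \<rhd> v))) = x \<rhd> (v \<cdot> (ev \<lhd> src2 D v))"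
      by (subst ev_natural) simp_all
    then have nat: "(x \<rhd> (ev \<lhd> x' \<lhd> M)) \<cdot> (x \<rhd> (x' \<rhd> (x \<rhd> v))) = (x \<rhd> v) \<cdot> (x \<rhd> (ev \<lhd> N))"
      by simp
    show "?xi \<cdot> (x \<rhd> (ev \<lhd> N)) = al \<cdot> (x \<rhd> (x' \<rhd> ?xi))"
      by (simp add: nat[symmetric] vcomp_reassoc[OF assoc])
  qed simp_all
qed

end

section \<open>*-2-functors and *-2-transformations\<close>

context star_2_functor
begin

lemma fun0_type [simp]: "a \<in> Ob0 C \<Longrightarrow> fun0 F a \<in> Ob0 D"
  by (fact fun0_in)

lemma fun1_type [simp]:
  assumes "X \<in> Ob1 C"
  shows "fun1 F X \<in> Ob1 D" "src1 D (fun1 F X) = fun0 F (src1 C X)"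
    "tgt1 D (fun1 F X) = fun0 F (tgt1 C X)"
  using fun1_in[of X "src1 C X" "tgt1 C X"] assms by (simp_all add: mem_cells1)

lemma fun2_type [simp]:
  assumes "f \<in> Ob2 C"
  shows "fun2 F f \<in> Ob2 D" "src2 D (fun2 F f) = fun1 F (src2 C f)"
    "tgt2 D (fun2 F f) = fun1 F (tgt2 C f)"
  using fun2_in[of f "src2 C f" "tgt2 C f"] assms by (simp_all add: mem_cells2)

lemma funmu_type [simp]:
  assumes "X \<in> Ob1 C" "Y \<in> Ob1 C" "src1 C X = tgt1 C Y"
  shows "funmu F X Y \<in> Ob2 D" "src2 D (funmu F X Y) = fun1 F X \<boxdot>\<^bsub>D\<^esub> fun1 F Y"
    "tgt2 D (funmu F X Y) = fun1 F (X \<boxdot>\<^bsub>C\<^esub> Y)"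
    "star2 D (funmu F X Y) \<cdot>\<^bsub>D\<^esub> funmu F X Y = id2 D (fun1 F X \<boxdot>\<^bsub>D\<^esub> fun1 F Y)"
    "funmu F X Y \<cdot>\<^bsub>D\<^esub> star2 D (funmu F X Y) = id2 D (fun1 F (X \<boxdot>\<^bsub>C\<^esub> Y))"
  using funmu_unitary[of X "tgt1 C Y" "tgt1 C X" Y "src1 C Y"] assms
  by (simp_all add: mem_cells1 mem_cells2 unitary2_def)

lemma funeta_type [simp]:
  assumes "a \<in> Ob0 C"
  shows "funeta F a \<in> Ob2 D" "src2 D (funeta F a) = id1 D (fun0 F a)"
    "tgt2 D (funeta F a) = fun1 F (id1 C a)"
    "star2 D (funeta F a) \<cdot>\<^bsub>D\<^esub> funeta F a = id2 D (id1 D (fun0 F a))"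
    "funeta F a \<cdot>\<^bsub>D\<^esub> star2 D (funeta F a) = id2 D (fun1 F (id1 C a))"
  using funeta_unitary[of a] assms by (simp_all add: mem_cells2 unitary2_def)

lemma fun2_id2' [simp]: "X \<in> Ob1 C \<Longrightarrow> fun2 F (id2 C X) = id2 D (fun1 F X)"
  by (fact fun2_id2)

lemma fun2_vcomp' [simp]:
  "f \<in> Ob2 C \<Longrightarrow> g \<in> Ob2 C \<Longrightarrow> src2 C g = tgt2 C f
    \<Longrightarrow> fun2 F (g \<cdot>\<^bsub>C\<^esub> f) = fun2 F g \<cdot>\<^bsub>D\<^esub> fun2 F f"
  using fun2_vcomp by (auto simp: mem_cells2)

lemma fun2_star' [simp]: "f \<in> Ob2 C \<Longrightarrow> fun2 F (star2 C f) = star2 D (fun2 F f)"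
  using fun2_star by (auto simp: mem_cells2)

lemma funmu_natural':
  assumes "f \<in> Ob2 C" "g \<in> Ob2 C" "src1 C (src2 C f) = tgt1 C (src2 C g)"
  shows "fun2 F (f \<boxtimes>\<^bsub>C\<^esub> g) \<cdot>\<^bsub>D\<^esub> funmu F (src2 C f) (src2 C g)
    = funmu F (tgt2 C f) (tgt2 C g) \<cdot>\<^bsub>D\<^esub> (fun2 F f \<boxtimes>\<^bsub>D\<^esub> fun2 F g)"
  using funmu_natural[of "src2 C f" _ _ "src2 C g" _ f _ g] assms
  by (auto simp: mem_cells1 mem_cells2)

lemma funmu_assoc':
  assumes "X \<in> Ob1 C" "Y \<in> Ob1 C" "Z \<in> Ob1 C" "src1 C X = tgt1 C Y" "src1 C Y = tgt1 C Z"
  shows "funmu F (X \<boxdot>\<^bsub>C\<^esub> Y) Z \<cdot>\<^bsub>D\<^esub> (funmu F X Y \<lhd>\<^bsub>D\<^esub> fun1 F Z)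
        = funmu F X (Y \<boxdot>\<^bsub>C\<^esub> Z) \<cdot>\<^bsub>D\<^esub> (fun1 F X \<rhd>\<^bsub>D\<^esub> funmu F Y Z)"
  using funmu_assoc[of X _ _ Y _ Z] assms by (auto simp: mem_cells1)

lemma funmu_unit [simp]:
  assumes "X \<in> Ob1 C"
  shows "funmu F (id1 C (tgt1 C X)) X \<cdot>\<^bsub>D\<^esub> (funeta F (tgt1 C X) \<lhd>\<^bsub>D\<^esub> fun1 F X) = id2 D (fun1 F X)"
    "funmu F X (id1 C (src1 C X)) \<cdot>\<^bsub>D\<^esub> (fun1 F X \<rhd>\<^bsub>D\<^esub> funeta F (src1 C X)) = id2 D (fun1 F X)"
  using funmu_unit_left[of X] funmu_unit_right[of X] assms by (auto simp: mem_cells1)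

end

context star_2_transformation
begin

lemma t0_type [simp]:
  assumes "a \<in> Ob0 C"
  shows "t0 a \<in> Ob1 D" "src1 D (t0 a) = fun0 F a" "tgt1 D (t0 a) = fun0 G a"
  using t0_in[of a] assms by (simp_all add: mem_cells1)

lemma t1_type [simp]:
  assumes "X \<in> Ob1 C"
  shows "t1 X \<in> Ob2 D" "src2 D (t1 X) = t0 (tgt1 C X) \<boxdot>\<^bsub>D\<^esub> fun1 F X"
    "tgt2 D (t1 X) = fun1 G X \<boxdot>\<^bsub>D\<^esub> t0 (src1 C X)"
    "star2 D (t1 X) \<cdot>\<^bsub>D\<^esub> t1 X = id2 D (t0 (tgt1 C X) \<boxdot>\<^bsub>D\<^esub> fun1 F X)"
    "t1 X \<cdot>\<^bsub>D\<^esub> star2 D (t1 X) = id2 D (fun1 G X \<boxdot>\<^bsub>D\<^esub> t0 (src1 C X))"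
  using t1_unitary[of X "src1 C X" "tgt1 C X"] assms
  by (simp_all add: mem_cells1 mem_cells2 unitary2_def)

lemma t1_hcomp':
  assumes "X \<in> Ob1 C" "Y \<in> Ob1 C" "src1 C X = tgt1 C Y"
  shows "(funmu G X Y \<lhd>\<^bsub>D\<^esub> t0 (src1 C Y))
            \<cdot>\<^bsub>D\<^esub> ((fun1 G X \<rhd>\<^bsub>D\<^esub> t1 Y) \<cdot>\<^bsub>D\<^esub> (t1 X \<lhd>\<^bsub>D\<^esub> fun1 F Y))
        = t1 (X \<boxdot>\<^bsub>C\<^esub> Y) \<cdot>\<^bsub>D\<^esub> (t0 (tgt1 C X) \<rhd>\<^bsub>D\<^esub> funmu F X Y)"
  using t1_hcomp[of X "tgt1 C Y" "tgt1 C X" Y "src1 C Y"] assms by (simp add: mem_cells1)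

lemma t1_natural':
  assumes "f \<in> Ob2 C"
  shows "(fun2 G f \<lhd>\<^bsub>D\<^esub> t0 (src1 C (src2 C f))) \<cdot>\<^bsub>D\<^esub> t1 (src2 C f)
    = t1 (tgt2 C f) \<cdot>\<^bsub>D\<^esub> (t0 (tgt1 C (src2 C f)) \<rhd>\<^bsub>D\<^esub> fun2 F f)"
  using t1_natural[of "src2 C f" _ _ f] assms by (simp add: mem_cells1 mem_cells2)

end

lemma star_2_transformationI:
  assumes "star_2_functor C D F" "star_2_functor C D G"
    and "\<And>a. a \<in> Ob0 C \<Longrightarrow> t0 a \<in> Ob1 D \<and> src1 D (t0 a) = fun0 F a \<and> tgt1 D (t0 a) = fun0 G a"
    and "\<And>X. X \<in> Ob1 C \<Longrightarrow> t1 X \<in> Ob2 D \<and> src2 D (t1 X) = t0 (tgt1 C X) \<boxdot>\<^bsub>D\<^esub> fun1 F X \<and>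
      tgt2 D (t1 X) = fun1 G X \<boxdot>\<^bsub>D\<^esub> t0 (src1 C X)"
    and "\<And>X. X \<in> Ob1 C \<Longrightarrow> star2 D (t1 X) \<cdot>\<^bsub>D\<^esub> t1 X = id2 D (t0 (tgt1 C X) \<boxdot>\<^bsub>D\<^esub> fun1 F X)"
    and "\<And>X. X \<in> Ob1 C \<Longrightarrow> t1 X \<cdot>\<^bsub>D\<^esub> star2 D (t1 X) = id2 D (fun1 G X \<boxdot>\<^bsub>D\<^esub> t0 (src1 C X))"
    and "\<And>X Y. X \<in> Ob1 C \<Longrightarrow> Y \<in> Ob1 C \<Longrightarrow> src1 C X = tgt1 C Y \<Longrightarrow>
      (funmu G X Y \<lhd>\<^bsub>D\<^esub> t0 (src1 C Y)) \<cdot>\<^bsub>D\<^esub> (fun1 G X \<rhd>\<^bsub>D\<^esub> t1 Y) \<cdot>\<^bsub>D\<^esub> (t1 X \<lhd>\<^bsub>D\<^esub> fun1 F Y)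
        = t1 (X \<boxdot>\<^bsub>C\<^esub> Y) \<cdot>\<^bsub>D\<^esub> (t0 (tgt1 C X) \<rhd>\<^bsub>D\<^esub> funmu F X Y)"
    and "\<And>f. f \<in> Ob2 C \<Longrightarrow> (fun2 G f \<lhd>\<^bsub>D\<^esub> t0 (src1 C (src2 C f))) \<cdot>\<^bsub>D\<^esub> t1 (src2 C f)
      = t1 (tgt2 C f) \<cdot>\<^bsub>D\<^esub> (t0 (tgt1 C (src2 C f)) \<rhd>\<^bsub>D\<^esub> fun2 F f)"
    and "\<And>a. a \<in> Ob0 C \<Longrightarrow>
      funeta G a \<lhd>\<^bsub>D\<^esub> t0 a = t1 (id1 C a) \<cdot>\<^bsub>D\<^esub> (t0 a \<rhd>\<^bsub>D\<^esub> funeta F a)"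
  shows "star_2_transformation C D F G t0 t1"
proof -
  interpret F: star_2_functor C D F by fact
  interpret G: star_2_functor C D G by fact
  show ?thesis
    by unfold_locales (use assms(3-) in \<open>auto simp: mem_cells1 mem_cells2 unitary2_def\<close>)
qed

lemma id_transformation:
  assumes "star_2_functor C D F"
  shows "star_2_transformation C D F F (\<lambda>a. id1 D (fun0 F a)) (\<lambda>X. id2 D (fun1 F X))"
proof -
  interpret F: star_2_functor C D F by fact
  show ?thesis
    by (rule star_2_transformationI) (simp_all add: assms)
qed

locale composable_transformations =
  S: star_2_transformation C D F G s0 s1 + T: star_2_transformation C D G H t0 t1
  for C :: "('o, 'm, 'c) two_cat" and D :: "('p, 'n, 'd) two_cat" (structure)
    and F G H s0 s1 t0 t1
begin

lemma comp_transformation: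
  "star_2_transformation C D F H (\<lambda>a. t0 a \<boxdot> s0 a)
     (\<lambda>X. (t1 X \<lhd> s0 (src1 C X)) \<cdot> (t0 (tgt1 C X) \<rhd> s1 X))"
proof (rule star_2_transformationI)
  fix X assume [simp]: "X \<in> Ob1 C"
  let ?r = "(t1 X \<lhd> s0 (src1 C X)) \<cdot> (t0 (tgt1 C X) \<rhd> s1 X)"
  show "star2 D ?r \<cdot> ?r = id2 D ((t0 (tgt1 C X) \<boxdot> s0 (tgt1 C X)) \<boxdot> fun1 F X)"
    by (simp add: S.F.D.cancel)
  show "?r \<cdot> star2 D ?r = id2 D (fun1 H X \<boxdot> (t0 (src1 C X) \<boxdot> s0 (src1 C X)))"
    by (simp add: S.F.D.cancel)
next
  fix X Y assume [simp]: "X \<in> Ob1 C" "Y \<in> Ob1 C" "src1 C X = tgt1 C Y"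
  show "(funmu H X Y \<lhd> (t0 (src1 C Y) \<boxdot> s0 (src1 C Y))) \<cdot>
        (fun1 H X \<rhd> ((t1 Y \<lhd> s0 (src1 C Y)) \<cdot> (t0 (tgt1 C Y) \<rhd> s1 Y))) \<cdot>
        (((t1 X \<lhd> s0 (src1 C X)) \<cdot> (t0 (tgt1 C X) \<rhd> s1 X)) \<lhd> fun1 F Y) =
        ((t1 (X \<boxdot>\<^bsub>C\<^esub> Y) \<lhd> s0 (src1 C (X \<boxdot>\<^bsub>C\<^esub> Y))) \<cdot> (t0 (tgt1 C (X \<boxdot>\<^bsub>C\<^esub> Y)) \<rhd> s1 (X \<boxdot>\<^bsub>C\<^esub> Y))) \<cdot>
        ((t0 (tgt1 C X) \<boxdot> s0 (tgt1 C X)) \<rhd> funmu F X Y)"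
  proof -
    \<comment> \<open>Once \<open>t1 X\<close> and \<open>s1 Y\<close> have changed places, the
      composition laws of the two transformations apply to separate blocks of the composite.\<close>
    note ex = S.F.D.exchange[of "s1 Y" "t1 X", simplified, symmetric]
    note tt = arg_cong[OF T.t1_hcomp'[of X Y], of "\<lambda>f. f \<lhd> s0 (src1 C Y)", simplified]
    note ss = arg_cong[OF S.t1_hcomp'[of X Y], of "\<lambda>f. t0 (tgt1 C X) \<rhd> f", simplified]
    show ?thesis
      by (simp add: S.F.D.vcomp_reassoc[OF ex] S.F.D.vcomp_reassoc3[OF tt] ss)
  qed
next
  fix f assume [simp]: "f \<in> Ob2 C"
  note tt = arg_cong[OF T.t1_natural'[of f], of "\<lambda>g. g \<lhd> s0 (src1 C (src2 C f))", simplified]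
  note ss = arg_cong[OF S.t1_natural'[of f], of "\<lambda>g. t0 (tgt1 C (src2 C f)) \<rhd> g", simplified]
  show "(fun2 H f \<lhd> (t0 (src1 C (src2 C f)) \<boxdot> s0 (src1 C (src2 C f)))) \<cdot>
      ((t1 (src2 C f) \<lhd> s0 (src1 C (src2 C f))) \<cdot> (t0 (tgt1 C (src2 C f)) \<rhd> s1 (src2 C f))) =
      ((t1 (tgt2 C f) \<lhd> s0 (src1 C (tgt2 C f))) \<cdot> (t0 (tgt1 C (tgt2 C f)) \<rhd> s1 (tgt2 C f))) \<cdot>
      ((t0 (tgt1 C (src2 C f)) \<boxdot> s0 (tgt1 C (src2 C f))) \<rhd> fun2 F f)"
    by (simp add: S.F.D.vcomp_reassoc[OF tt] ss)
next
  fix a assume [simp]: "a \<in> Ob0 C"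
  note tt = arg_cong[OF T.t1_unit[of a], of "\<lambda>g. g \<lhd> s0 a", simplified]
  note ss = arg_cong[OF S.t1_unit[of a], of "\<lambda>g. t0 a \<rhd> g", simplified]
  show "funeta H a \<lhd> (t0 a \<boxdot> s0 a) =
      ((t1 (id1 C a) \<lhd> s0 (src1 C (id1 C a))) \<cdot> (t0 (tgt1 C (id1 C a)) \<rhd> s1 (id1 C a))) \<cdot>
      ((t0 a \<boxdot> s0 a) \<rhd> funeta F a)"
    by (simp add: tt ss)
qed (simp_all add: S.F.star_2_functor_axioms T.G.star_2_functor_axioms)

end

text \<open>Transport of structure along unitaries chosen independently at each 0-cell. In the
  composition law the inner copies of \<open>u\<close> cancel; the outer ones slide past the
  structure cells of \<open>F\<close> and \<open>G\<close>.\<close>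

lemma (in star_2_transformation) conjugate_transformation:
  assumes [simp]: "\<And>a. a \<in> Ob0 C \<Longrightarrow> u a \<in> Ob2 D" "\<And>a. a \<in> Ob0 C \<Longrightarrow> src2 D (u a) = t0 a"
      "\<And>a. a \<in> Ob0 C \<Longrightarrow> tgt2 D (u a) = r0 a"
      "\<And>a. a \<in> Ob0 C \<Longrightarrow> star2 D (u a) \<cdot>\<^bsub>D\<^esub> u a = id2 D (t0 a)"
      "\<And>a. a \<in> Ob0 C \<Longrightarrow> u a \<cdot>\<^bsub>D\<^esub> star2 D (u a) = id2 D (r0 a)"
  shows "star_2_transformation C D F G r0 (\<lambda>X. (fun1 G X \<rhd>\<^bsub>D\<^esub> u (src1 C X)) \<cdot>\<^bsub>D\<^esub>
    t1 X \<cdot>\<^bsub>D\<^esub> (star2 D (u (tgt1 C X)) \<lhd>\<^bsub>D\<^esub> fun1 F X))"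
proof -
  have r0 [simp]: "r0 a \<in> Ob1 D" "src1 D (r0 a) = fun0 F a" "tgt1 D (r0 a) = fun0 G a"
    if "a \<in> Ob0 C" for a
    using that F.D.Ob1_cells(2)[of "u a"] F.D.parallel[of "u a"] by simp_all
  show ?thesis
  proof (rule star_2_transformationI, goal_cases)
    case (7 X Y)
    then have [simp]: "X \<in> Ob1 C" "Y \<in> Ob1 C" "src1 C X = tgt1 C Y"
      by auto
    note ex1 = F.D.exchange[of "u (src1 C Y)" "funmu G X Y", simplified]
    note ex2 = F.D.exchange[of "funmu F X Y" "star2 D (u (tgt1 C X))", simplified]
    show ?case
      by (simp add: F.D.cancel F.D.vcomp_reassoc[OF ex1] ex2 F.D.vcomp_reassoc3[OF t1_hcomp'])
  next
    case (8 f)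
    then have [simp]: "f \<in> Ob2 C" .
    note ex1 = F.D.exchange[of "u (src1 C (src2 C f))" "fun2 G f", simplified]
    note ex2 = F.D.exchange[of "fun2 F f" "star2 D (u (tgt1 C (src2 C f)))", simplified]
    show ?case
      by (simp add: F.D.vcomp_reassoc[OF ex1] ex2 F.D.vcomp_reassoc[OF t1_natural'])
  next
    case (9 a)
    then have [simp]: "a \<in> Ob0 C" .
    note ex1 = F.D.exchange[of "u a" "funeta G a", simplified]
    note ex2 = F.D.exchange[of "funeta F a" "star2 D (u a)", simplified]
    show ?case
      by (simp add: ex2 F.D.vcomp_reassoc[OF t1_unit[symmetric]] F.D.vcomp_reassoc[OF ex1[symmetric]])
  qed (simp_all add: F.star_2_functor_axioms G.star_2_functor_axioms F.D.cancel)
qed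

section \<open>Splitting a Q-system of *-2-functors\<close>

text \<open>A Q-system whose 1-cells literally are \<open>x a \<boxdot> x' a\<close>. The assumption
  \<open>mult\<close> is the modification law for the multiplication with components
  \<open>x a \<rhd> (ev a \<lhd> x' a)\<close>, written in whiskered normal form.\<close>

locale split_q_system =
  T: star_2_transformation C D F F "\<lambda>a. hcomp1 D (x a) (x' a)" t1
  for C :: "('o, 'm, 'c) two_cat" and D :: "('p, 'n, 'd) two_cat" (structure)
    and F :: "('o, 'm, 'c, 'p, 'n, 'd) two_functor" and x x' :: "'o \<Rightarrow> 'n" and t1 :: "'m \<Rightarrow> 'd" +
  fixes ev :: "'o \<Rightarrow> 'd"
  assumes dual: "a \<in> Ob0 C \<Longrightarrow> separable_dual D (x a) (x' a) (ev a)"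
    and mult: "X \<in> Ob1 C \<Longrightarrow>
      t1 X \<cdot> (x (tgt1 C X) \<rhd> (ev (tgt1 C X) \<lhd> x' (tgt1 C X) \<lhd> fun1 F X))
      = (fun1 F X \<rhd> (x (src1 C X) \<rhd> (ev (src1 C X) \<lhd> x' (src1 C X)))) \<cdot>
        ((t1 X \<lhd> x (src1 C X) \<lhd> x' (src1 C X)) \<cdot> (x (tgt1 C X) \<rhd> (x' (tgt1 C X) \<rhd> t1 X)))"
begin

lemma dual_type [simp]:
  assumes "a \<in> Ob0 C"
  shows "x a \<in> Ob1 D" "x' a \<in> Ob1 D" "src1 D (x' a) = fun0 F a" "tgt1 D (x' a) = src1 D (x a)"
    "tgt1 D (x a) = fun0 F a" "ev a \<in> Ob2 D" "src2 D (ev a) = x' a \<boxdot> x a"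
    "tgt2 D (ev a) = id1 D (src1 D (x a))"
    "ev a \<cdot> star2 D (ev a) = id2 D (id1 D (src1 D (x a)))"
proof -
  interpret separable_dual D "x a" "x' a" "ev a"
    by (rule dual[OF assms])
  show "x a \<in> Ob1 D" "x' a \<in> Ob1 D" "src1 D (x' a) = fun0 F a" "tgt1 D (x' a) = src1 D (x a)"
    "tgt1 D (x a) = fun0 F a" "ev a \<in> Ob2 D" "src2 D (ev a) = x' a \<boxdot> x a"
    "tgt2 D (ev a) = id1 D (src1 D (x a))"
    "ev a \<cdot> star2 D (ev a) = id2 D (id1 D (src1 D (x a)))"
    using T.t0_type[OF assms] by (simp_all add: ev_coisometry)
qed

text \<open>The action on \<open>fun1 F X \<boxdot> x a\<close>, for \<open>X\<close> from
  \<open>a\<close> to \<open>b\<close>: \<open>t1 X\<close> carries the algebra at \<open>b\<close>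
  past \<open>fun1 F X\<close>, where it becomes the algebra at \<open>a\<close> and is absorbed
  into \<open>x a\<close> by \<open>ev a\<close>.\<close>

definition act :: "'m \<Rightarrow> 'd" where
  "act X = (fun1 F X \<rhd> (x (src1 C X) \<rhd> ev (src1 C X))) \<cdot> (t1 X \<lhd> x (src1 C X))"

lemma act_type [simp]:
  assumes "X \<in> Ob1 C"
  shows "act X \<in> Ob2 D"
    "src2 D (act X) = x (tgt1 C X) \<boxdot> (x' (tgt1 C X) \<boxdot> (fun1 F X \<boxdot> x (src1 C X)))"
    "tgt2 D (act X) = fun1 F X \<boxdot> x (src1 C X)"
  using assms by (simp_all add: act_def)

text \<open>The law \<open>mult\<close> turns the multiplication at the target of \<open>X\<close>
  into the one at its source. What is left are two contractions by \<open>ev\<close>, which commute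
  by exchange, and a contraction sliding past \<open>t1 X\<close>.\<close>

lemma act_assoc:
  assumes [simp]: "X \<in> Ob1 C"
  shows "act X \<cdot> (x (tgt1 C X) \<rhd> (ev (tgt1 C X) \<lhd> x' (tgt1 C X) \<lhd> (fun1 F X \<boxdot> x (src1 C X))))
    = act X \<cdot> (x (tgt1 C X) \<rhd> (x' (tgt1 C X) \<rhd> act X))"
proof -
  note m = arg_cong[OF mult[OF assms], of "\<lambda>f. f \<lhd> x (src1 C X)", simplified]
  note ex1 = arg_cong[OF T.F.D.exchange[of "ev (src1 C X)" "ev (src1 C X)"],
      of "\<lambda>f. fun1 F X \<rhd> (x (src1 C X) \<rhd> f)", simplified]
  note ex2 = T.F.D.exchange[of "x (src1 C X) \<rhd> ev (src1 C X)" "t1 X", simplified]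
  show ?thesis
    by (simp add: act_def m T.F.D.vcomp_reassoc[OF ex1] T.F.D.vcomp_reassoc[OF ex2])
qed

lemma act_coisometry:
  assumes [simp]: "X \<in> Ob1 C"
  shows "act X \<cdot> star2 D (act X) = id2 D (fun1 F X \<boxdot> x (src1 C X))"
  by (simp add: act_def T.F.D.cancel)

text \<open>The law rests on the adjoint of \<open>mult\<close>, the unitarity of
  \<open>t1 X\<close>, and the exchange of \<open>ev\<close> with its own adjoint.\<close>

lemma act_frobenius:
  assumes [simp]: "X \<in> Ob1 C"
  shows "star2 D (act X) \<cdot> act X = (x (tgt1 C X) \<rhd> (x' (tgt1 C X) \<rhd> act X)) \<cdot>
    (x (tgt1 C X) \<rhd> (star2 D (ev (tgt1 C X)) \<lhd> x' (tgt1 C X) \<lhd> (fun1 F X \<boxdot> x (src1 C X))))"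
proof -
  let ?a = "src1 C X" and ?b = "tgt1 C X"
  note m = arg_cong[OF mult[OF assms], of "\<lambda>f. star2 D f \<lhd> x ?a", simplified]
  \<comment> \<open>The adjoint of \<open>mult\<close> speaks of the comultiplication preceded by
    the adjoint of \<open>t1 X\<close>. To use it for the comultiplication alone, the identity is
    inserted as that adjoint composed with \<open>t1 X\<close>.\<close>
  have "(x ?b \<rhd> (star2 D (ev ?b) \<lhd> x' ?b \<lhd> fun1 F X \<lhd> x ?a)) =
    ((x ?b \<rhd> (star2 D (ev ?b) \<lhd> x' ?b \<lhd> fun1 F X \<lhd> x ?a)) \<cdot> (star2 D (t1 X) \<lhd> x ?a)) \<cdot> (t1 X \<lhd> x ?a)"
    by (simp add: T.F.D.cancel)
  also have "\<dots> = (x ?b \<rhd> (x' ?b \<rhd> (star2 D (t1 X) \<lhd> x ?a))) \<cdot>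
     ((star2 D (t1 X) \<lhd> x ?a \<lhd> x' ?a \<lhd> x ?a) \<cdot>
      ((fun1 F X \<rhd> (x ?a \<rhd> (star2 D (ev ?a) \<lhd> x' ?a \<lhd> x ?a))) \<cdot> (t1 X \<lhd> x ?a)))"
    by (simp add: m)
  finally have e: "(x ?b \<rhd> (star2 D (ev ?b) \<lhd> x' ?b \<lhd> fun1 F X \<lhd> x ?a)) = \<dots>" .
  note ex1 = arg_cong[OF T.F.D.exchange[of "ev ?a" "star2 D (ev ?a)"],
      of "\<lambda>f. fun1 F X \<rhd> (x ?a \<rhd> f)", simplified]
  note ex2 = T.F.D.exchange[of "x ?a \<rhd> ev ?a" "star2 D (t1 X)", simplified]
  show ?thesis
    by (simp add: act_def e T.F.D.cancel T.F.D.vcomp_reassoc[OF ex1[symmetric]]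
        T.F.D.vcomp_reassoc[OF ex2[symmetric]])
qed

lemma splitting_exists:
  assumes "locally_projection_complete D" and [simp]: "X \<in> Ob1 C"
  obtains N xi where "N \<in> Ob1 D" "src1 D N = src1 D (x (src1 C X))" "tgt1 D N = src1 D (x (tgt1 C X))"
    "xi \<in> Ob2 D" "src2 D xi = x (tgt1 C X) \<boxdot> N" "tgt2 D xi = fun1 F X \<boxdot> x (src1 C X)"
    "star2 D xi \<cdot> xi = id2 D (x (tgt1 C X) \<boxdot> N)"
    "xi \<cdot> star2 D xi = id2 D (fun1 F X \<boxdot> x (src1 C X))"
    "xi \<cdot> (x (tgt1 C X) \<rhd> (ev (tgt1 C X) \<lhd> N)) = act X \<cdot> (x (tgt1 C X) \<rhd> (x' (tgt1 C X) \<rhd> xi))"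
  by (rule separable_dual.module_splits[OF dual assms(1), of "tgt1 C X" "fun1 F X \<boxdot> x (src1 C X)" "act X"])
    (use act_assoc[of X] act_coisometry[of X] act_frobenius[of X] that in simp_all)

end

section \<open>Constructing the cells of \<open>G\<close> and of the dual transformation by
  factoring through \<open>xi\<close>\<close>

locale split_q_system_modules = split_q_system C D F x x' t1 ev
  for C :: "('o, 'm, 'c) two_cat" and D :: "('p, 'n, 'd) two_cat" (structure)
    and F x x' t1 ev +
  fixes g1 :: "'m \<Rightarrow> 'n" and xi :: "'m \<Rightarrow> 'd"
  assumes g1_type [simp]: "X \<in> Ob1 C \<Longrightarrow> g1 X \<in> Ob1 D"
      "X \<in> Ob1 C \<Longrightarrow> src1 D (g1 X) = src1 D (x (src1 C X))"
      "X \<in> Ob1 C \<Longrightarrow> tgt1 D (g1 X) = src1 D (x (tgt1 C X))"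
    and xi_type [simp]: "X \<in> Ob1 C \<Longrightarrow> xi X \<in> Ob2 D"
      "X \<in> Ob1 C \<Longrightarrow> src2 D (xi X) = x (tgt1 C X) \<boxdot> g1 X"
      "X \<in> Ob1 C \<Longrightarrow> tgt2 D (xi X) = fun1 F X \<boxdot> x (src1 C X)"
    and xi_unitary [simp]: "X \<in> Ob1 C \<Longrightarrow> star2 D (xi X) \<cdot> xi X = id2 D (x (tgt1 C X) \<boxdot> g1 X)"
      "X \<in> Ob1 C \<Longrightarrow> xi X \<cdot> star2 D (xi X) = id2 D (fun1 F X \<boxdot> x (src1 C X))"
    and xi_linear: "X \<in> Ob1 C \<Longrightarrow> xi X \<cdot> (x (tgt1 C X) \<rhd> (ev (tgt1 C X) \<lhd> g1 X))
      = act X \<cdot> (x (tgt1 C X) \<rhd> (x' (tgt1 C X) \<rhd> xi X))"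
begin

text \<open>The test by which the laws of \<open>G\<close> are proved: composing with
  \<open>xi X\<close> turns whiskered cells of \<open>G\<close> into cells of \<open>F\<close>,
  where the law is known.\<close>

lemma whisker_eq_if_xi:
  assumes "xi X \<cdot> (x (tgt1 C X) \<rhd> f) = xi X \<cdot> (x (tgt1 C X) \<rhd> g)" "X \<in> Ob1 C"
    "f \<in> Ob2 D" "g \<in> Ob2 D" "src2 D g = src2 D f" "tgt2 D f = g1 X" "tgt2 D g = g1 X"
  shows "f = g"
  using assms T.F.D.parallel[of f]
  by (intro separable_dual.factor_unique[OF dual assms(1)]) auto

text \<open>The image of \<open>f\<close> under \<open>F\<close> commutes with the actions because
  \<open>t1\<close> is natural, so it factors through the free modules. The equation imposed on
  \<open>h\<close> is naturality of \<open>xi\<close> as a transformation from \<open>G\<close> to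
  \<open>F\<close>.\<close>

lemma functor_2cell_exists:
  assumes [simp]: "f \<in> Ob2 C"
  obtains h where "h \<in> Ob2 D" "src2 D h = g1 (src2 C f)" "tgt2 D h = g1 (tgt2 C f)"
    "xi (tgt2 C f) \<cdot> (x (tgt1 C (src2 C f)) \<rhd> h)
      = (fun2 F f \<lhd> x (src1 C (src2 C f))) \<cdot> xi (src2 C f)"
proof -
  let ?X = "src2 C f" and ?Y = "tgt2 C f" and ?a = "src1 C (src2 C f)" and ?b = "tgt1 C (src2 C f)"
  note ex = T.F.D.exchange[of "x ?a \<rhd> ev ?a" "fun2 F f", simplified]
  note nat = arg_cong[OF T.t1_natural'[of f], of "\<lambda>g. g \<lhd> x ?a", simplified]
  have lin: "((fun2 F f \<lhd> x ?a) \<cdot> xi ?X) \<cdot> (x ?b \<rhd> (ev ?b \<lhd> g1 ?X))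
      = act ?Y \<cdot> (x ?b \<rhd> (x' ?b \<rhd> ((fun2 F f \<lhd> x ?a) \<cdot> xi ?X)))"
    by (simp add: xi_linear act_def T.F.D.vcomp_reassoc[OF ex] T.F.D.vcomp_reassoc[OF nat])
  show ?thesis
    by (rule separable_dual.factor_module_map[OF dual, of ?b "g1 ?X" "g1 ?Y" "xi ?Y" "fun1 F ?Y \<boxdot> x ?a"
          "act ?Y" "(fun2 F f \<lhd> x ?a) \<cdot> xi ?X"])
      (use lin xi_linear[of ?Y] that in simp_all)
qed

text \<open>Linearity of the right side: \<open>xi X\<close> passes the action of the algebra at the
  target of \<open>X\<close> to the middle 0-cell, \<open>xi Y\<close> passes it on to the source of
  \<open>Y\<close>, and the composition law of \<open>t1\<close> merges the two passages into the
  action for the composite of \<open>X\<close> and \<open>Y\<close>.\<close>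

lemma functor_mu_exists:
  assumes [simp]: "X \<in> Ob1 C" "Y \<in> Ob1 C" "src1 C X = tgt1 C Y"
  obtains h where "h \<in> Ob2 D" "src2 D h = g1 X \<boxdot> g1 Y" "tgt2 D h = g1 (X \<boxdot>\<^bsub>C\<^esub> Y)"
    "star2 D h \<cdot> h = id2 D (g1 X \<boxdot> g1 Y)" "h \<cdot> star2 D h = id2 D (g1 (X \<boxdot>\<^bsub>C\<^esub> Y))"
    "xi (X \<boxdot>\<^bsub>C\<^esub> Y) \<cdot> (x (tgt1 C X) \<rhd> h)
      = (funmu F X Y \<lhd> x (src1 C Y)) \<cdot> ((fun1 F X \<rhd> xi Y) \<cdot> (xi X \<lhd> g1 Y))"
proof -
  let ?a = "tgt1 C Y" and ?b = "tgt1 C X" and ?c = "src1 C Y"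
  define k where "k = (funmu F X Y \<lhd> x ?c) \<cdot> ((fun1 F X \<rhd> xi Y) \<cdot> (xi X \<lhd> g1 Y))"
  have k [simp]: "k \<in> Ob2 D" "src2 D k = x ?b \<boxdot> (g1 X \<boxdot> g1 Y)" "tgt2 D k = fun1 F (X \<boxdot>\<^bsub>C\<^esub> Y) \<boxdot> x ?c"
    "star2 D k \<cdot> k = id2 D (x ?b \<boxdot> (g1 X \<boxdot> g1 Y))" "k \<cdot> star2 D k = id2 D (fun1 F (X \<boxdot>\<^bsub>C\<^esub> Y) \<boxdot> x ?c)"
    by (simp_all add: k_def T.F.D.cancel)
  note linX = arg_cong[OF xi_linear[of X], of "\<lambda>f. f \<lhd> g1 Y", unfolded act_def, simplified]
  note linY = arg_cong[OF xi_linear[of Y], of "\<lambda>f. fun1 F X \<rhd> f", unfolded act_def, simplified]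
  note ex1 = T.F.D.exchange[of "xi Y" "t1 X", simplified]
  note ex2 = T.F.D.exchange[of "x ?c \<rhd> ev ?c" "funmu F X Y", simplified]
  note tt = arg_cong[OF T.t1_hcomp'[of X Y], of "\<lambda>f. f \<lhd> x ?c", simplified]
  have lin: "k \<cdot> (x ?b \<rhd> (ev ?b \<lhd> (g1 X \<boxdot> g1 Y))) = act (X \<boxdot>\<^bsub>C\<^esub> Y) \<cdot> (x ?b \<rhd> (x' ?b \<rhd> k))"
    by (simp add: k_def act_def linX T.F.D.vcomp_reassoc[OF linY] T.F.D.vcomp_reassoc[OF ex1[symmetric]]
        T.F.D.vcomp_reassoc[OF ex2] T.F.D.vcomp_reassoc3[OF tt])
  obtain h where h: "h \<in> Ob2 D" "src2 D h = g1 X \<boxdot> g1 Y" "tgt2 D h = g1 (X \<boxdot>\<^bsub>C\<^esub> Y)"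
      "xi (X \<boxdot>\<^bsub>C\<^esub> Y) \<cdot> (x (tgt1 C X) \<rhd> h) = k"
    by (rule separable_dual.factor_module_map[OF dual, of ?b "g1 X \<boxdot> g1 Y" "g1 (X \<boxdot>\<^bsub>C\<^esub> Y)"
          "xi (X \<boxdot>\<^bsub>C\<^esub> Y)" "fun1 F (X \<boxdot>\<^bsub>C\<^esub> Y) \<boxdot> x ?c" "act (X \<boxdot>\<^bsub>C\<^esub> Y)" k])
      (use lin xi_linear[of "X \<boxdot>\<^bsub>C\<^esub> Y"] in simp_all)
  moreover have "star2 D h \<cdot> h = id2 D (src2 D h)" "h \<cdot> star2 D h = id2 D (tgt2 D h)"
    using h by (intro separable_dual.factor_unitary[OF dual, of ?b h "xi (X \<boxdot>\<^bsub>C\<^esub> Y)" k]; simp)+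
  ultimately show ?thesis
    using that k_def by simp
qed

text \<open>The 1-cell \<open>x a\<close> is regarded as the free module on an identity 1-cell;
  linearity is the unit law of \<open>t1\<close>.\<close>

lemma functor_eta_exists:
  assumes [simp]: "a \<in> Ob0 C"
  obtains h where "h \<in> Ob2 D" "src2 D h = id1 D (src1 D (x a))" "tgt2 D h = g1 (id1 C a)"
    "star2 D h \<cdot> h = id2 D (id1 D (src1 D (x a)))" "h \<cdot> star2 D h = id2 D (g1 (id1 C a))"
    "xi (id1 C a) \<cdot> (x a \<rhd> h) = funeta F a \<lhd> x a"
proof -
  let ?k = "funeta F a \<lhd> x a" and ?I = "id1 D (src1 D (x a))"
  note ex = T.F.D.exchange[of "x a \<rhd> ev a" "funeta F a", simplified]
  note unit = arg_cong[OF T.t1_unit[of a], of "\<lambda>f. f \<lhd> x a", simplified]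
  have lin: "?k \<cdot> (x a \<rhd> (ev a \<lhd> ?I)) = act (id1 C a) \<cdot> (x a \<rhd> (x' a \<rhd> ?k))"
    by (simp add: ex unit act_def)
  obtain h where h: "h \<in> Ob2 D" "src2 D h = ?I" "tgt2 D h = g1 (id1 C a)"
      "xi (id1 C a) \<cdot> (x a \<rhd> h) = ?k"
    by (rule separable_dual.factor_module_map[OF dual, of a ?I "g1 (id1 C a)" "xi (id1 C a)"
          "fun1 F (id1 C a) \<boxdot> x a" "act (id1 C a)" ?k])
      (use lin xi_linear[of "id1 C a"] in \<open>simp_all add: T.F.D.cancel\<close>)
  moreover have "star2 D h \<cdot> h = id2 D (src2 D h)" "h \<cdot> star2 D h = id2 D (tgt2 D h)"
    using h by (intro separable_dual.factor_unitary[OF dual, of a h "xi (id1 C a)" ?k];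
        simp add: T.F.D.cancel)+
  ultimately show ?thesis
    using that by simp
qed

text \<open>The law \<open>mult\<close> says exactly that \<open>t1 X\<close> is a module map. Its
  source is free on \<open>x' (tgt1 C X) \<boxdot> fun1 F X\<close>, and
  \<open>xi X \<lhd> x' (src1 C X)\<close> exhibits its target as free on
  \<open>g1 X \<boxdot> x' (src1 C X)\<close>.\<close>

lemma dual_transformation_exists:
  assumes [simp]: "X \<in> Ob1 C"
  obtains h where "h \<in> Ob2 D" "src2 D h = x' (tgt1 C X) \<boxdot> fun1 F X"
    "tgt2 D h = g1 X \<boxdot> x' (src1 C X)"
    "star2 D h \<cdot> h = id2 D (x' (tgt1 C X) \<boxdot> fun1 F X)"
    "h \<cdot> star2 D h = id2 D (g1 X \<boxdot> x' (src1 C X))"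
    "(xi X \<lhd> x' (src1 C X)) \<cdot> (x (tgt1 C X) \<rhd> h) = t1 X"
proof -
  let ?a = "src1 C X" and ?b = "tgt1 C X"
  note lin = arg_cong[OF xi_linear[of X], of "\<lambda>f. f \<lhd> x' ?a", simplified]
  obtain h where h: "h \<in> Ob2 D" "src2 D h = x' ?b \<boxdot> fun1 F X" "tgt2 D h = g1 X \<boxdot> x' ?a"
      "(xi X \<lhd> x' ?a) \<cdot> (x ?b \<rhd> h) = t1 X"
    by (rule separable_dual.factor_module_map[OF dual, of ?b "x' ?b \<boxdot> fun1 F X" "g1 X \<boxdot> x' ?a"
          "xi X \<lhd> x' ?a" "fun1 F X \<boxdot> (x ?a \<boxdot> x' ?a)" "act X \<lhd> x' ?a" "t1 X"])
      (use lin mult[of X] in \<open>simp_all add: T.F.D.cancel act_def\<close>)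
  moreover have "star2 D h \<cdot> h = id2 D (src2 D h)" "h \<cdot> star2 D h = id2 D (tgt2 D h)"
    using h by (intro separable_dual.factor_unitary[OF dual, of ?b h "xi X \<lhd> x' ?a" "t1 X"];
        simp add: T.F.D.cancel)+
  ultimately show ?thesis
    using that by simp
qed

end

section \<open>The laws of the functor \<open>G\<close> and of the two transformations
  \<open>xi\<close> and \<open>th\<close>\<close>

locale split_q_system_functor = split_q_system_modules C D F x x' t1 ev "fun1 G" xi
  for C :: "('o, 'm, 'c) two_cat" and D :: "('p, 'n, 'd) two_cat" (structure)
    and F x x' t1 ev and G :: "('o, 'm, 'c, 'p, 'n, 'd) two_functor" and xi +
  fixes th :: "'m \<Rightarrow> 'd"
  assumes g0 [simp]: "a \<in> Ob0 C \<Longrightarrow> fun0 G a = src1 D (x a)"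
    and g2_type [simp]: "f \<in> Ob2 C \<Longrightarrow> fun2 G f \<in> Ob2 D"
      "f \<in> Ob2 C \<Longrightarrow> src2 D (fun2 G f) = fun1 G (src2 C f)"
      "f \<in> Ob2 C \<Longrightarrow> tgt2 D (fun2 G f) = fun1 G (tgt2 C f)"
    and xi_g2: "f \<in> Ob2 C \<Longrightarrow> xi (tgt2 C f) \<cdot> (x (tgt1 C (src2 C f)) \<rhd> fun2 G f)
      = (fun2 F f \<lhd> x (src1 C (src2 C f))) \<cdot> xi (src2 C f)"
    and gmu_type [simp]: "\<lbrakk>X \<in> Ob1 C; Y \<in> Ob1 C; src1 C X = tgt1 C Y\<rbrakk> \<Longrightarrow> funmu G X Y \<in> Ob2 D"
      "\<lbrakk>X \<in> Ob1 C; Y \<in> Ob1 C; src1 C X = tgt1 C Y\<rbrakk> \<Longrightarrow> src2 D (funmu G X Y) = fun1 G X \<boxdot> fun1 G Y"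
      "\<lbrakk>X \<in> Ob1 C; Y \<in> Ob1 C; src1 C X = tgt1 C Y\<rbrakk> \<Longrightarrow> tgt2 D (funmu G X Y) = fun1 G (X \<boxdot>\<^bsub>C\<^esub> Y)"
      "\<lbrakk>X \<in> Ob1 C; Y \<in> Ob1 C; src1 C X = tgt1 C Y\<rbrakk>
        \<Longrightarrow> star2 D (funmu G X Y) \<cdot> funmu G X Y = id2 D (fun1 G X \<boxdot> fun1 G Y)"
      "\<lbrakk>X \<in> Ob1 C; Y \<in> Ob1 C; src1 C X = tgt1 C Y\<rbrakk>
        \<Longrightarrow> funmu G X Y \<cdot> star2 D (funmu G X Y) = id2 D (fun1 G (X \<boxdot>\<^bsub>C\<^esub> Y))"
    and xi_gmu: "\<lbrakk>X \<in> Ob1 C; Y \<in> Ob1 C; src1 C X = tgt1 C Y\<rbrakk>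
        \<Longrightarrow> xi (X \<boxdot>\<^bsub>C\<^esub> Y) \<cdot> (x (tgt1 C X) \<rhd> funmu G X Y)
          = (funmu F X Y \<lhd> x (src1 C Y)) \<cdot> ((fun1 F X \<rhd> xi Y) \<cdot> (xi X \<lhd> fun1 G Y))"
    and geta_type [simp]: "a \<in> Ob0 C \<Longrightarrow> funeta G a \<in> Ob2 D"
      "a \<in> Ob0 C \<Longrightarrow> src2 D (funeta G a) = id1 D (src1 D (x a))"
      "a \<in> Ob0 C \<Longrightarrow> tgt2 D (funeta G a) = fun1 G (id1 C a)"
      "a \<in> Ob0 C \<Longrightarrow> star2 D (funeta G a) \<cdot> funeta G a = id2 D (id1 D (src1 D (x a)))"
      "a \<in> Ob0 C \<Longrightarrow> funeta G a \<cdot> star2 D (funeta G a) = id2 D (fun1 G (id1 C a))"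
    and xi_geta: "a \<in> Ob0 C \<Longrightarrow> xi (id1 C a) \<cdot> (x a \<rhd> funeta G a) = funeta F a \<lhd> x a"
    and th_type [simp]: "X \<in> Ob1 C \<Longrightarrow> th X \<in> Ob2 D"
      "X \<in> Ob1 C \<Longrightarrow> src2 D (th X) = x' (tgt1 C X) \<boxdot> fun1 F X"
      "X \<in> Ob1 C \<Longrightarrow> tgt2 D (th X) = fun1 G X \<boxdot> x' (src1 C X)"
      "X \<in> Ob1 C \<Longrightarrow> star2 D (th X) \<cdot> th X = id2 D (x' (tgt1 C X) \<boxdot> fun1 F X)"
      "X \<in> Ob1 C \<Longrightarrow> th X \<cdot> star2 D (th X) = id2 D (fun1 G X \<boxdot> x' (src1 C X))"
    and xi_th: "X \<in> Ob1 C \<Longrightarrow> (xi X \<lhd> x' (src1 C X)) \<cdot> (x (tgt1 C X) \<rhd> th X) = t1 X"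
begin

lemma g2_id2:
  assumes [simp]: "X \<in> Ob1 C"
  shows "fun2 G (id2 C X) = id2 D (fun1 G X)"
  by (rule whisker_eq_if_xi[of X]) (use xi_g2[of "id2 C X"] in simp_all)

lemma g2_vcomp:
  assumes [simp]: "f \<in> Ob2 C" "g \<in> Ob2 C" "src2 C g = tgt2 C f"
  shows "fun2 G (g \<cdot>\<^bsub>C\<^esub> f) = fun2 G g \<cdot> fun2 G f"
proof (rule whisker_eq_if_xi[of "tgt2 C g"])
  note e = xi_g2[of "g \<cdot>\<^bsub>C\<^esub> f", simplified] xi_g2[of g, simplified] xi_g2[of f, simplified]
  show "xi (tgt2 C g) \<cdot> (x (tgt1 C (tgt2 C g)) \<rhd> fun2 G (g \<cdot>\<^bsub>C\<^esub> f)) =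
    xi (tgt2 C g) \<cdot> (x (tgt1 C (tgt2 C g)) \<rhd> (fun2 G g \<cdot> fun2 G f))"
    using T.F.C.parallel[of g] by (simp add: e T.F.D.vcomp_reassoc[OF e(2)])
qed simp_all

lemma g2_add:
  assumes [simp]: "f \<in> Ob2 C" "g \<in> Ob2 C" "src2 C g = src2 C f" "tgt2 C g = tgt2 C f"
  shows "fun2 G (add2 C f g) = add2 D (fun2 G f) (fun2 G g)"
proof -
  have F: "fun2 F (add2 C f g) = add2 D (fun2 F f) (fun2 F g)"
    by (rule T.F.fun2_add) (simp_all add: mem_cells2)
  show ?thesis
    by (rule whisker_eq_if_xi[of "tgt2 C f"])
      (use xi_g2[of f] xi_g2[of g] xi_g2[of "add2 C f g"] in \<open>simp_all add: F
        T.F.D.whisker_add T.F.D.vcomp_linear_left T.F.D.vcomp_linear_right\<close>)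
qed

lemma g2_scale:
  assumes [simp]: "f \<in> Ob2 C"
  shows "fun2 G (scale2 C z f) = scale2 D z (fun2 G f)"
proof -
  have F: "fun2 F (scale2 C z f) = scale2 D z (fun2 F f)"
    by (rule T.F.fun2_scale) (simp_all add: mem_cells2)
  show ?thesis
    by (rule whisker_eq_if_xi[of "tgt2 C f"])
      (use xi_g2[of f] xi_g2[of "scale2 C z f"] in \<open>simp_all add: F
        T.F.D.whisker_scale T.F.D.vcomp_linear_left T.F.D.vcomp_linear_right\<close>)
qed

lemma g2_star:
  assumes [simp]: "f \<in> Ob2 C"
  shows "fun2 G (star2 C f) = star2 D (fun2 G f)"
proof (rule whisker_eq_if_xi[of "src2 C f"])
  let ?a = "src1 C (src2 C f)" and ?b = "tgt1 C (src2 C f)"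
  \<comment> \<open>Taking adjoints in \<open>xi_g2\<close> puts the adjoints of \<open>xi\<close>
    on the wrong sides; composing with \<open>xi\<close> at both ends turns the result into the
    equation that determines the image of the adjoint of \<open>f\<close>.\<close>
  have "xi (src2 C f) \<cdot> star2 D (xi (tgt2 C f) \<cdot> (x ?b \<rhd> fun2 G f)) \<cdot> xi (tgt2 C f)
    = xi (src2 C f) \<cdot> star2 D ((fun2 F f \<lhd> x ?a) \<cdot> xi (src2 C f)) \<cdot> xi (tgt2 C f)"
    by (simp only: xi_g2[OF assms])
  then have e: "xi (src2 C f) \<cdot> (x ?b \<rhd> star2 D (fun2 G f)) = (star2 D (fun2 F f) \<lhd> x ?a) \<cdot> xi (tgt2 C f)"
    by (simp add: T.F.D.cancel)
  show "xi (src2 C f) \<cdot> (x ?b \<rhd> fun2 G (star2 C f)) = xi (src2 C f) \<cdot> (x ?b \<rhd> star2 D (fun2 G f))"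
    using xi_g2[of "star2 C f"] by (simp add: e)
qed simp_all

lemma gmu_natural:
  assumes [simp]: "f \<in> Ob2 C" "g \<in> Ob2 C" "src1 C (src2 C f) = tgt1 C (src2 C g)"
  shows "fun2 G (f \<boxtimes>\<^bsub>C\<^esub> g) \<cdot> funmu G (src2 C f) (src2 C g)
    = funmu G (tgt2 C f) (tgt2 C g) \<cdot> (fun2 G f \<boxtimes> fun2 G g)"
proof -
  let ?X = "src2 C f" and ?Y = "src2 C g" and ?X' = "tgt2 C f" and ?Y' = "tgt2 C g"
  let ?b = "tgt1 C ?X" and ?a = "tgt1 C ?Y" and ?c = "src1 C ?Y"
  have hG: "fun2 G f \<boxtimes> fun2 G g = (fun2 G f \<lhd> fun1 G ?Y') \<cdot> (fun1 G ?X \<rhd> fun2 G g)"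
    using T.F.D.hcomp2_eq[of "fun2 G g" "fun2 G f"] by simp
  have hF: "fun2 F f \<boxtimes> fun2 F g = (fun2 F f \<lhd> fun1 F ?Y') \<cdot> (fun1 F ?X \<rhd> fun2 F g)"
    using T.F.D.hcomp2_eq[of "fun2 F g" "fun2 F f"] by simp
  note nat = arg_cong[OF T.F.funmu_natural'[OF assms, unfolded hF], of "\<lambda>h. h \<lhd> x ?c", simplified]
  note efg = xi_g2[of "f \<boxtimes>\<^bsub>C\<^esub> g", simplified]
  note mu = xi_gmu[of ?X ?Y, simplified] xi_gmu[of ?X' ?Y', simplified]
  note ef = arg_cong[OF xi_g2[of f], of "\<lambda>h. h \<lhd> fun1 G ?Y'", simplified]
  note eg = arg_cong[OF xi_g2[of g], of "\<lambda>h. fun1 F ?X \<rhd> h", simplified]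
  note ex1 = T.F.D.exchange[of "xi ?Y'" "fun2 F f", simplified]
  note ex2 = T.F.D.exchange[of "fun2 G g" "xi ?X", simplified]
  show ?thesis
    unfolding hG
    by (rule whisker_eq_if_xi[of "?X' \<boxdot>\<^bsub>C\<^esub> ?Y'"])
     (simp_all add: T.F.D.vcomp_reassoc[OF efg] mu T.F.D.vcomp_reassoc[OF mu(2)]
        T.F.D.vcomp_reassoc[OF nat] ef T.F.D.vcomp_reassoc[OF ef]
        T.F.D.vcomp_reassoc[OF ex1[symmetric]] ex2 T.F.D.vcomp_reassoc[OF eg])
qed

text \<open>Under \<open>xi\<close> both sides become a coherence cell of \<open>F\<close> applied
  after \<open>xi X\<close>, \<open>xi Y\<close> and \<open>xi Z\<close>. Exchange brings the three
  into the same order, and associativity for \<open>F\<close> finishes.\<close>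

lemma gmu_assoc:
  assumes [simp]: "X \<in> Ob1 C" "Y \<in> Ob1 C" "Z \<in> Ob1 C" "src1 C X = tgt1 C Y" "src1 C Y = tgt1 C Z"
  shows "funmu G (X \<boxdot>\<^bsub>C\<^esub> Y) Z \<cdot> (funmu G X Y \<lhd> fun1 G Z)
        = funmu G X (Y \<boxdot>\<^bsub>C\<^esub> Z) \<cdot> (fun1 G X \<rhd> funmu G Y Z)"
proof -
  note mu1 = xi_gmu[of "X \<boxdot>\<^bsub>C\<^esub> Y" Z, simplified]
  note mu2 = xi_gmu[of X "Y \<boxdot>\<^bsub>C\<^esub> Z", simplified]
  note mu3 = arg_cong[OF xi_gmu[of X Y], of "\<lambda>h. h \<lhd> fun1 G Z", simplified]
  note mu4 = arg_cong[OF xi_gmu[of Y Z], of "\<lambda>h. fun1 F X \<rhd> h", simplified]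
  note assoc = arg_cong[OF T.F.funmu_assoc'[of X Y Z], of "\<lambda>h. h \<lhd> x (src1 C Z)", simplified]
  note ex1 = T.F.D.exchange[of "xi Z" "funmu F X Y", simplified]
  note ex2 = T.F.D.exchange[of "funmu G Y Z" "xi X", simplified]
  show ?thesis
    by (rule whisker_eq_if_xi[of "X \<boxdot>\<^bsub>C\<^esub> (Y \<boxdot>\<^bsub>C\<^esub> Z)"])
      (simp_all add: T.F.D.vcomp_reassoc[OF mu1] T.F.D.vcomp_reassoc[OF mu2] mu3 ex2
        T.F.D.vcomp_reassoc[OF ex1[symmetric]] T.F.D.vcomp_reassoc[OF assoc]
        T.F.D.vcomp_reassoc[OF mu4])
qed

lemma gmu_unit:
  assumes [simp]: "X \<in> Ob1 C"
  shows "funmu G (id1 C (tgt1 C X)) X \<cdot> (funeta G (tgt1 C X) \<lhd> fun1 G X) = id2 D (fun1 G X)" (is ?l)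
    and "funmu G X (id1 C (src1 C X)) \<cdot> (fun1 G X \<rhd> funeta G (src1 C X)) = id2 D (fun1 G X)" (is ?r)
proof -
  let ?a = "src1 C X" and ?b = "tgt1 C X"
  note mul = xi_gmu[of "id1 C ?b" X, simplified] and mur = xi_gmu[of X "id1 C ?a", simplified]
  note etal = arg_cong[OF xi_geta[of ?b], of "\<lambda>h. h \<lhd> fun1 G X", simplified]
  note etar = arg_cong[OF xi_geta[of ?a], of "\<lambda>h. fun1 F X \<rhd> h", simplified]
  note ur = arg_cong[OF T.F.funmu_unit(2)[of X], of "\<lambda>h. h \<lhd> x ?a"]
  have ur: "(funmu F X (id1 C ?a) \<lhd> x ?a) \<cdot> (fun1 F X \<rhd> (funeta F ?a \<lhd> x ?a)) = id2 D (fun1 F X \<boxdot> x ?a)"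
    using ur by (simp del: T.F.funmu_unit)
  note exl = T.F.D.exchange[of "xi X" "funeta F ?b", simplified]
  note exr = T.F.D.exchange[of "funeta G ?a" "xi X", simplified]
  show ?l
    by (rule whisker_eq_if_xi[of X])
      (simp_all add: T.F.D.vcomp_reassoc[OF mul] etal exl[symmetric] T.F.D.cancel)
  show ?r
    by (rule whisker_eq_if_xi[of X])
      (simp_all add: T.F.D.vcomp_reassoc[OF mur] exr T.F.D.vcomp_reassoc[OF etar]
        T.F.D.vcomp_reassoc[OF ur])
qed

lemma splitting_functor: "star_2_functor C D G"
  by unfold_locales
    (auto simp: mem_cells1 mem_cells2 unitary2_def g2_id2 g2_vcomp g2_add g2_scale g2_star gmu_natural
    gmu_assoc gmu_unit)

sublocale G: star_2_functor C D G
  by (rule splitting_functor)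

text \<open>The equations that determine the cells of \<open>G\<close> are precisely the axioms of a
  transformation for \<open>xi\<close>.\<close>

lemma splitting_transformation: "star_2_transformation C D G F x xi"
  by (rule star_2_transformationI)
    (simp_all add: G.star_2_functor_axioms T.F.star_2_functor_axioms xi_gmu xi_g2 xi_geta)

lemma th_eqI:
  assumes "(xi X \<lhd> x' (src1 C X)) \<cdot> (x (tgt1 C X) \<rhd> f) = (xi X \<lhd> x' (src1 C X)) \<cdot> (x (tgt1 C X) \<rhd> g)"
    "X \<in> Ob1 C" "f \<in> Ob2 D" "g \<in> Ob2 D" "src2 D g = src2 D f" "tgt2 D f = fun1 G X \<boxdot> x' (src1 C X)"
    "tgt2 D g = fun1 G X \<boxdot> x' (src1 C X)"
  shows "f = g"
  using assms T.F.D.parallel[of f]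
  by (intro separable_dual.factor_unique[OF dual assms(1)]) (auto simp: T.F.D.cancel)

text \<open>By \<open>xi_th\<close>, \<open>t1\<close> is the composite of \<open>xi\<close> after
  \<open>th\<close>. Applying \<open>xi\<close> reduces each axiom for \<open>th\<close> to the same
  axiom for \<open>t1\<close>.\<close>

lemma dual_transformation: "star_2_transformation C D F G x' th"
proof (rule star_2_transformationI)
  fix X Y assume [simp]: "X \<in> Ob1 C" "Y \<in> Ob1 C" "src1 C X = tgt1 C Y"
  let ?a = "tgt1 C Y" and ?b = "tgt1 C X" and ?c = "src1 C Y"
  note mu = arg_cong[OF xi_gmu[of X Y], of "\<lambda>h. h \<lhd> x' ?c", simplified]
  note th = xi_th[of "X \<boxdot>\<^bsub>C\<^esub> Y", simplified]
  note thX = arg_cong[OF xi_th[of X], of "\<lambda>h. h \<lhd> fun1 F Y", simplified]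
  note thY = arg_cong[OF xi_th[of Y], of "\<lambda>h. fun1 F X \<rhd> h", simplified]
  note ex = T.F.D.exchange[of "th Y" "xi X", simplified]
  show "(funmu G X Y \<lhd> x' ?c) \<cdot> (fun1 G X \<rhd> th Y) \<cdot> (th X \<lhd> fun1 F Y)
      = th (X \<boxdot>\<^bsub>C\<^esub> Y) \<cdot> (x' ?b \<rhd> funmu F X Y)"
    by (rule th_eqI[of "X \<boxdot>\<^bsub>C\<^esub> Y"])
      (simp_all add: T.F.D.vcomp_reassoc[OF mu] T.F.D.vcomp_reassoc[OF th] T.F.D.vcomp_reassoc[OF ex]
        T.F.D.vcomp_reassoc[OF thY] thX T.t1_hcomp'[of X Y, simplified])
next
  fix f assume [simp]: "f \<in> Ob2 C"
  let ?X = "src2 C f" and ?Y = "tgt2 C f"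
  let ?a = "src1 C ?X" and ?b = "tgt1 C ?X"
  note e = arg_cong[OF xi_g2[of f], of "\<lambda>h. h \<lhd> x' ?a", simplified]
  note thX = xi_th[of ?X, simplified] and thY = xi_th[of ?Y, simplified]
  show "(fun2 G f \<lhd> x' ?a) \<cdot> th ?X = th ?Y \<cdot> (x' ?b \<rhd> fun2 F f)"
    by (rule th_eqI[of ?Y])
      (use T.t1_natural'[of f] in \<open>simp_all add: T.F.D.vcomp_reassoc[OF e] thX
        T.F.D.vcomp_reassoc[OF thY]\<close>)
next
  fix a assume [simp]: "a \<in> Ob0 C"
  note e = arg_cong[OF xi_geta[of a], of "\<lambda>h. h \<lhd> x' a", simplified]
  note th = xi_th[of "id1 C a", simplified]
  show "funeta G a \<lhd> x' a = th (id1 C a) \<cdot> (x' a \<rhd> funeta F a)"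
    by (rule th_eqI[of "id1 C a"])
      (use T.t1_unit[of a] in \<open>simp_all add: e T.F.D.vcomp_reassoc[OF th]\<close>)
qed (simp_all add: G.star_2_functor_axioms T.F.star_2_functor_axioms)

text \<open>This is the modification law for \<open>ev\<close>, from the composite of
  \<open>x'\<close> after \<open>x\<close> to the identity of \<open>G\<close>. Under
  \<open>xi X\<close> it becomes \<open>xi_linear\<close>, with \<open>t1 X\<close> in the action
  written through \<open>xi X\<close> and \<open>th X\<close>.\<close>

lemma ev_natural:
  assumes [simp]: "X \<in> Ob1 C"
  shows "ev (tgt1 C X) \<lhd> fun1 G X
    = (fun1 G X \<rhd> ev (src1 C X)) \<cdot> ((th X \<lhd> x (src1 C X)) \<cdot> (x' (tgt1 C X) \<rhd> xi X))"
proof -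
  note th = arg_cong[OF xi_th[of X], of "\<lambda>h. h \<lhd> x (src1 C X)", simplified]
  note ex = T.F.D.exchange[of "ev (src1 C X)" "xi X", simplified]
  show ?thesis
    by (rule whisker_eq_if_xi[of X])
      (simp_all add: xi_linear act_def T.F.D.vcomp_reassoc[OF ex] T.F.D.vcomp_reassoc[OF th])
qed

end

section \<open>Q-systems in the 2-category of *-2-functors\<close>

text \<open>Companion of \<open>conjugate_transformation\<close>: the modification law of the
  multiplication survives transport along \<open>u\<close>. It supplies the assumption
  \<open>mult\<close> of \<open>split_q_system\<close>.\<close>

lemma conjugate_multiplication:
  fixes D :: "('p, 'n, 'd) two_cat" (structure)
  assumes "star_2_transformation C D F F s0 s1"
    and u [simp]: "\<And>a. a \<in> Ob0 C \<Longrightarrow> u a \<in> Ob2 D" "\<And>a. a \<in> Ob0 C \<Longrightarrow> src2 D (u a) = s0 a"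
      "\<And>a. a \<in> Ob0 C \<Longrightarrow> tgt2 D (u a) = r0 a"
      "\<And>a. a \<in> Ob0 C \<Longrightarrow> star2 D (u a) \<cdot> u a = id2 D (s0 a)"
      "\<And>a. a \<in> Ob0 C \<Longrightarrow> u a \<cdot> star2 D (u a) = id2 D (r0 a)"
    and m [simp]: "\<And>a. a \<in> Ob0 C \<Longrightarrow> m a \<in> Ob2 D" "\<And>a. a \<in> Ob0 C \<Longrightarrow> src2 D (m a) = s0 a \<boxdot> s0 a"
      "\<And>a. a \<in> Ob0 C \<Longrightarrow> tgt2 D (m a) = s0 a"
    and m' [simp]: "\<And>a. a \<in> Ob0 C \<Longrightarrow> m' a \<in> Ob2 D" "\<And>a. a \<in> Ob0 C \<Longrightarrow> src2 D (m' a) = r0 a \<boxdot> r0 a"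
      "\<And>a. a \<in> Ob0 C \<Longrightarrow> tgt2 D (m' a) = r0 a"
    and um: "\<And>a. a \<in> Ob0 C \<Longrightarrow> u a \<cdot> m a = m' a \<cdot> (u a \<boxtimes> u a)"
    and X [simp]: "X \<in> Ob1 C"
    and nat: "s1 X \<cdot> (m (tgt1 C X) \<lhd> fun1 F X)
      = (fun1 F X \<rhd> m (src1 C X)) \<cdot> ((s1 X \<lhd> s0 (src1 C X)) \<cdot> (s0 (tgt1 C X) \<rhd> s1 X))"
    and r1: "r1 = (fun1 F X \<rhd> u (src1 C X)) \<cdot> s1 X \<cdot> (star2 D (u (tgt1 C X)) \<lhd> fun1 F X)"
  shows "r1 \<cdot> (m' (tgt1 C X) \<lhd> fun1 F X)
      = (fun1 F X \<rhd> m' (src1 C X)) \<cdot> ((r1 \<lhd> r0 (src1 C X)) \<cdot> (r0 (tgt1 C X) \<rhd> r1))"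
proof -
  interpret S: star_2_transformation C D F F s0 s1 by fact
  have r0 [simp]: "r0 a \<in> Ob1 D" "src1 D (r0 a) = fun0 F a" "tgt1 D (r0 a) = fun0 F a"
    if "a \<in> Ob0 C" for a
    using that S.F.D.Ob1_cells(2)[of "u a"] S.F.D.parallel[of "u a"] by simp_all
  have um': "u a \<cdot> m a = m' a \<cdot> ((u a \<lhd> r0 a) \<cdot> (s0 a \<rhd> u a))" if "a \<in> Ob0 C" for a
    using um[OF that] S.F.D.hcomp2_eq[of "u a" "u a"] that by simp
  \<comment> \<open>The equation \<open>um'\<close> is solved for \<open>m'\<close>, so that only
    \<open>m\<close> and copies of \<open>u\<close> and its adjoint remain.\<close>
  have m'_eq: "m' a = u a \<cdot> (m a \<cdot> ((s0 a \<rhd> star2 D (u a)) \<cdot> (star2 D (u a) \<lhd> r0 a)))"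
    if [simp]: "a \<in> Ob0 C" for a
    by (simp add: S.F.D.vcomp_reassoc[OF um'] S.F.D.cancel)
  let ?a = "src1 C X" and ?b = "tgt1 C X"
  have mb: "m' ?b \<lhd> fun1 F X = (u ?b \<lhd> fun1 F X) \<cdot> ((m ?b \<lhd> fun1 F X) \<cdot>
      ((s0 ?b \<rhd> (star2 D (u ?b) \<lhd> fun1 F X)) \<cdot> (star2 D (u ?b) \<lhd> r0 ?b \<lhd> fun1 F X)))"
    by (subst m'_eq) simp_all
  have ma: "fun1 F X \<rhd> m' ?a = (fun1 F X \<rhd> u ?a) \<cdot> ((fun1 F X \<rhd> m ?a) \<cdot>
      ((fun1 F X \<rhd> (s0 ?a \<rhd> star2 D (u ?a))) \<cdot> (fun1 F X \<rhd> (star2 D (u ?a) \<lhd> r0 ?a))))"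
    by (subst m'_eq) simp_all
  have r1_type [simp]: "r1 \<in> Ob2 D" "src2 D r1 = r0 ?b \<boxdot> fun1 F X" "tgt2 D r1 = fun1 F X \<boxdot> r0 ?a"
    by (simp_all add: r1)
  note ex1 = S.F.D.exchange[of "star2 D (u ?a)" "s1 X", simplified]
  have "(r1 \<lhd> r0 ?a) \<cdot> (r0 ?b \<rhd> r1) = (fun1 F X \<rhd> (u ?a \<lhd> r0 ?a)) \<cdot> ((s1 X \<lhd> r0 ?a) \<cdot>
      ((star2 D (u ?b) \<lhd> (fun1 F X \<boxdot> r0 ?a)) \<cdot> (r0 ?b \<rhd> r1)))"
    by (simp add: r1)
  \<comment> \<open>The cell \<open>r1\<close> stays folded, so a single exchange moves the adjoint
    of \<open>u ?b\<close> past all of it.\<close>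
  also have "(star2 D (u ?b) \<lhd> (fun1 F X \<boxdot> r0 ?a)) \<cdot> (r0 ?b \<rhd> r1)
      = (s0 ?b \<rhd> r1) \<cdot> (star2 D (u ?b) \<lhd> (r0 ?b \<boxdot> fun1 F X))"
    using S.F.D.exchange[of r1 "star2 D (u ?b)"] by simp
  finally show ?thesis
    by (simp add: ma mb S.F.D.cancel) (simp add: r1 S.F.D.cancel S.F.D.vcomp_reassoc[OF nat]
        S.F.D.vcomp_reassoc[OF ex1[symmetric]])
qed

section \<open>The cells of \<open>fun_2cat\<close> and their components\<close>

lemma star_2_transformation_cong:
  assumes "star_2_transformation C D F G t0 t1"
    and [simp]: "\<And>a. a \<in> Ob0 C \<Longrightarrow> t0' a = t0 a" "\<And>X. X \<in> Ob1 C \<Longrightarrow> t1' X = t1 X"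
  shows "star_2_transformation C D F G t0' t1'"
proof -
  interpret T: star_2_transformation C D F G t0 t1 by fact
  show ?thesis
    by (rule star_2_transformationI)
      (simp_all add: T.F.star_2_functor_axioms T.G.star_2_functor_axioms T.t1_hcomp' T.t1_natural' T.t1_unit)
qed

text \<open>The stored families are \<open>undefined\<close> away from the cells of
  \<open>C\<close>. The axioms see only values on cells, so restricting does no harm.\<close>

lemma transformationsI:
  assumes "F \<in> functors C D" "G \<in> functors C D" "star_2_transformation C D F G t0 t1"
  shows "\<lparr>tr_src = F, tr_tgt = G, tr0 = restrict t0 (Ob0 C), tr1 = restrict t1 (Ob1 C)\<rparr>
    \<in> transformations C D"
  using assms by (auto simp: transformations_def intro: star_2_transformation_cong)

lemma transf_comp_in:
  assumes "s \<in> transformations C D" "t \<in> transformations C D" "tr_tgt s = tr_src t"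
  shows "transf_comp C D t s \<in> transformations C D"
proof -
  interpret composable_transformations C D "tr_src s" "tr_src t" "tr_tgt t" "tr0 s" "tr1 s" "tr0 t" "tr1 t"
    using assms by (simp add: composable_transformations_def transformations_def)
  show ?thesis
    unfolding transf_comp_def using assms comp_transformation
    by (intro transformationsI) (auto simp: transformations_def)
qed

lemma transf_id_in:
  assumes "F \<in> functors C D"
  shows "transf_id C D F \<in> transformations C D"
  unfolding transf_id_def using assms
  by (intro transformationsI id_transformation) (auto simp: functors_def)

text \<open>Equality of transformations is equality of records and includes agreement away from the
  cells of \<open>C\<close>; this is where extensionality enters.\<close>

lemma transf_comp_id:
  assumes "t \<in> transformations C D"
  shows "transf_comp C D (transf_id C D (tr_tgt t)) t = t"
    and "transf_comp C D t (transf_id C D (tr_src t)) = t"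
proof -
  interpret T: star_2_transformation C D "tr_src t" "tr_tgt t" "tr0 t" "tr1 t"
    using assms by (simp add: transformations_def)
  have "tr0 t \<in> extensional (Ob0 C)" "tr1 t \<in> extensional (Ob1 C)"
    using assms by (simp_all add: transformations_def)
  then show "transf_comp C D (transf_id C D (tr_tgt t)) t = t"
    "transf_comp C D t (transf_id C D (tr_src t)) = t"
    by (auto intro!: transf.equality extensionalityI[of _ "Ob0 C"] extensionalityI[of _ "Ob1 C"]
        simp: transf_comp_def transf_id_def)
qed

lemma modificationsI:
  assumes "s \<in> transformations C D" "t \<in> transformations C D"
    and "tr_src s = F" "tr_src t = F" "tr_tgt s = G" "tr_tgt t = G"
    and "\<And>a. a \<in> Ob0 C \<Longrightarrow> n a \<in> cells2 D (tr0 s a) (tr0 t a)"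
    and bound: "\<And>a. a \<in> Ob0 C \<Longrightarrow> norm2 D (n a) \<le> B"
    and "\<And>X. X \<in> Ob1 C \<Longrightarrow> tr1 t X \<cdot>\<^bsub>D\<^esub> (n (tgt1 C X) \<lhd>\<^bsub>D\<^esub> fun1 F X)
      = (fun1 G X \<rhd>\<^bsub>D\<^esub> n (src1 C X)) \<cdot>\<^bsub>D\<^esub> tr1 s X"
  shows "\<lparr>md_src = s, md_tgt = t, md = restrict n (Ob0 C)\<rparr> \<in> modifications C D"
proof -
  interpret S: star_2_transformation C D F G "tr0 s" "tr1 s"
    using assms by (simp add: transformations_def)
  interpret T: star_2_transformation C D F G "tr0 t" "tr1 t"
    using assms by (simp add: transformations_def)
  have "bdd_above ((\<lambda>a. norm2 D (restrict n (Ob0 C) a)) ` Ob0 C)"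
    using bound by (intro bdd_aboveI[of _ B]) auto
  then have "star_2_modification C D F G (tr0 s) (tr1 s) (tr0 t) (tr1 t) (restrict n (Ob0 C))"
    by unfold_locales (use assms in \<open>auto simp: mem_cells1\<close>)
  then show ?thesis
    using assms by (simp add: modifications_def)
qed

lemma fun_2cat_cells:
  "F \<in> Ob0 (fun_2cat C D) \<longleftrightarrow> F \<in> functors C D"
  "t \<in> cells1 (fun_2cat C D) F G \<longleftrightarrow> t \<in> transformations C D \<and> tr_src t = F \<and> tr_tgt t = G"
  "n \<in> cells2 (fun_2cat C D) s t \<longleftrightarrow> n \<in> modifications C D \<and> md_src n = s \<and> md_tgt n = t"
  by (simp_all add: fun_2cat_def cells1_def cells2_def)

lemma modification_natural:
  assumes "n \<in> modifications C D" "X \<in> Ob1 C"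
  shows "tr1 (md_tgt n) X \<cdot>\<^bsub>D\<^esub> (md n (tgt1 C X) \<lhd>\<^bsub>D\<^esub> fun1 (tr_src (md_src n)) X)
    = (fun1 (tr_tgt (md_src n)) X \<rhd>\<^bsub>D\<^esub> md n (src1 C X)) \<cdot>\<^bsub>D\<^esub> tr1 (md_src n) X"
proof -
  interpret star_2_modification C D "tr_src (md_src n)" "tr_tgt (md_src n)"
    "tr0 (md_src n)" "tr1 (md_src n)" "tr0 (md_tgt n)" "tr1 (md_tgt n)" "md n"
    using assms unfolding modifications_def by blast
  show ?thesis
    using mod_natural[of X] assms(2) by (simp add: mem_cells1)
qed

lemma modification_component:
  assumes "n \<in> modifications C D" "a \<in> Ob0 C"
  shows "md n a \<in> cells2 D (tr0 (md_src n) a) (tr0 (md_tgt n) a)"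
proof -
  interpret star_2_modification C D "tr_src (md_src n)" "tr_tgt (md_src n)"
    "tr0 (md_src n)" "tr1 (md_src n)" "tr0 (md_tgt n)" "tr1 (md_tgt n)" "md n"
    using assms unfolding modifications_def by blast
  show ?thesis
    using mod_in assms(2) .
qed

text \<open>Compositions, identities and the involution of \<open>fun_2cat\<close> act
  componentwise, so evaluating each Q-system equation at \<open>a\<close> gives the same equation in
  \<open>D\<close>.\<close>

lemma q_system_component:
  assumes q: "q_system (fun_2cat C D) F Q m i" and a: "a \<in> Ob0 C"
  shows "q_system D (fun0 F a) (tr0 Q a) (md m a) (md i a)"
proof -
  let ?E = "fun_2cat C D"
  have cells: "Q \<in> transformations C D" "tr_src Q = F" "tr_tgt Q = F" "m \<in> modifications C D"
      "md_src m = transf_comp C D Q Q" "md_tgt m = Q" "i \<in> modifications C D"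
      "md_src i = transf_id C D F" "md_tgt i = Q"
    using q by (simp_all add: q_system_def fun_2cat_cells) (simp_all add: fun_2cat_def)
  interpret Q: star_2_transformation C D F F "tr0 Q" "tr1 Q"
    using cells by (auto simp: transformations_def)
  have m: "md m a \<in> cells2 D (tr0 Q a \<boxdot>\<^bsub>D\<^esub> tr0 Q a) (tr0 Q a)"
    and i: "md i a \<in> cells2 D (id1 D (fun0 F a)) (tr0 Q a)"
    using modification_component[OF cells(4) a] modification_component[OF cells(7) a] cells a
    by (simp_all add: transf_comp_def transf_id_def)
  from q obtain
    e1: "m \<cdot>\<^bsub>?E\<^esub> (m \<lhd>\<^bsub>?E\<^esub> Q) = m \<cdot>\<^bsub>?E\<^esub> (Q \<rhd>\<^bsub>?E\<^esub> m)" and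
    e2: "m \<cdot>\<^bsub>?E\<^esub> (i \<lhd>\<^bsub>?E\<^esub> Q) = id2 ?E Q" and
    e3: "m \<cdot>\<^bsub>?E\<^esub> (Q \<rhd>\<^bsub>?E\<^esub> i) = id2 ?E Q" and
    e4: "(Q \<rhd>\<^bsub>?E\<^esub> m) \<cdot>\<^bsub>?E\<^esub> (star2 ?E m \<lhd>\<^bsub>?E\<^esub> Q) = star2 ?E m \<cdot>\<^bsub>?E\<^esub> m" and
    e5: "(m \<lhd>\<^bsub>?E\<^esub> Q) \<cdot>\<^bsub>?E\<^esub> (Q \<rhd>\<^bsub>?E\<^esub> star2 ?E m) = star2 ?E m \<cdot>\<^bsub>?E\<^esub> m" and
    e6: "m \<cdot>\<^bsub>?E\<^esub> star2 ?E m = id2 ?E Q"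
    by (auto simp: q_system_def)
  show ?thesis
    using m i a arg_cong[OF e1, of "\<lambda>n. md n a"] arg_cong[OF e2, of "\<lambda>n. md n a"]
      arg_cong[OF e3, of "\<lambda>n. md n a"] arg_cong[OF e4, of "\<lambda>n. md n a"]
      arg_cong[OF e5, of "\<lambda>n. md n a"] arg_cong[OF e6, of "\<lambda>n. md n a"]
    by (simp add: q_system_def Q.t0_in fun_2cat_def)
qed

section \<open>Choosing the functor and its transformations\<close>

lemma (in split_q_system_modules) functor_exists:
  obtains G th where "split_q_system_functor C D F x x' t1 ev G xi th" "G \<in> functors C D"
proof -
  let ?P2 = "\<lambda>f h. h \<in> Ob2 D \<and> src2 D h = g1 (src2 C f) \<and> tgt2 D h = g1 (tgt2 C f) \<and>
    xi (tgt2 C f) \<cdot> (x (tgt1 C (src2 C f)) \<rhd> h) = (fun2 F f \<lhd> x (src1 C (src2 C f))) \<cdot> xi (src2 C f)"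
  let ?Pm = "\<lambda>X Y h. h \<in> Ob2 D \<and> src2 D h = g1 X \<boxdot> g1 Y \<and> tgt2 D h = g1 (X \<boxdot>\<^bsub>C\<^esub> Y) \<and>
    star2 D h \<cdot> h = id2 D (g1 X \<boxdot> g1 Y) \<and> h \<cdot> star2 D h = id2 D (g1 (X \<boxdot>\<^bsub>C\<^esub> Y)) \<and>
    xi (X \<boxdot>\<^bsub>C\<^esub> Y) \<cdot> (x (tgt1 C X) \<rhd> h)
      = (funmu F X Y \<lhd> x (src1 C Y)) \<cdot> ((fun1 F X \<rhd> xi Y) \<cdot> (xi X \<lhd> g1 Y))"
  let ?Pe = "\<lambda>a h. h \<in> Ob2 D \<and> src2 D h = id1 D (src1 D (x a)) \<and> tgt2 D h = g1 (id1 C a) \<and>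
    star2 D h \<cdot> h = id2 D (id1 D (src1 D (x a))) \<and> h \<cdot> star2 D h = id2 D (g1 (id1 C a)) \<and>
    xi (id1 C a) \<cdot> (x a \<rhd> h) = funeta F a \<lhd> x a"
  let ?Pt = "\<lambda>X h. h \<in> Ob2 D \<and> src2 D h = x' (tgt1 C X) \<boxdot> fun1 F X \<and>
    tgt2 D h = g1 X \<boxdot> x' (src1 C X) \<and> star2 D h \<cdot> h = id2 D (x' (tgt1 C X) \<boxdot> fun1 F X) \<and>
    h \<cdot> star2 D h = id2 D (g1 X \<boxdot> x' (src1 C X)) \<and>
    (xi X \<lhd> x' (src1 C X)) \<cdot> (x (tgt1 C X) \<rhd> h) = t1 X"
  have "\<forall>f \<in> Ob2 C. \<exists>h. ?P2 f h"
    by (rule ballI, rule functor_2cell_exists) blast+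
  then obtain g2 where g2: "\<forall>f \<in> Ob2 C. ?P2 f (g2 f)"
    by (rule bchoice[THEN exE])
  \<comment> \<open>The cells \<open>funmu\<close> depend on two 1-cells, so the choice is made over
    composable pairs.\<close>
  let ?composable = "{(X, Y). X \<in> Ob1 C \<and> Y \<in> Ob1 C \<and> src1 C X = tgt1 C Y}"
  have "\<exists>h. ?Pm X Y h" if "X \<in> Ob1 C" "Y \<in> Ob1 C" "src1 C X = tgt1 C Y" for X Y
    by (rule functor_mu_exists[OF that]) blast
  then have "\<forall>XY \<in> ?composable. \<exists>h. ?Pm (fst XY) (snd XY) h"
    by auto
  then obtain gm where gm: "\<forall>XY \<in> ?composable. ?Pm (fst XY) (snd XY) (gm XY)"
    by (rule bchoice[THEN exE])
  have gm: "?Pm X Y (gm (X, Y))" if "X \<in> Ob1 C" "Y \<in> Ob1 C" "src1 C X = tgt1 C Y" for X Y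
    using bspec[OF gm, of "(X, Y)"] that by simp
  have "\<forall>a \<in> Ob0 C. \<exists>h. ?Pe a h"
    by (rule ballI, rule functor_eta_exists) blast+
  then obtain ge where ge: "\<forall>a \<in> Ob0 C. ?Pe a (ge a)"
    by (rule bchoice[THEN exE])
  have "\<forall>X \<in> Ob1 C. \<exists>h. ?Pt X h"
    by (rule ballI, rule dual_transformation_exists) blast+
  then obtain th where th: "\<forall>X \<in> Ob1 C. ?Pt X (th X)"
    by (rule bchoice[THEN exE])
  \<comment> \<open>The default values away from the cells of \<open>C\<close> are those demanded by
    \<open>functors\<close>, so that \<open>G\<close> is an object of
    \<open>fun_2cat\<close>.\<close>
  define G where "G = \<lparr>fun0 = \<lambda>a\<in>Ob0 C. src1 D (x a), fun1 = restrict g1 (Ob1 C),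
    fun2 = restrict g2 (Ob2 C),
    funmu = \<lambda>X Y. if X \<in> Ob1 C \<and> Y \<in> Ob1 C \<and> src1 C X = tgt1 C Y then gm (X, Y) else undefined,
    funeta = restrict ge (Ob0 C)\<rparr>"
  interpret G: split_q_system_functor C D F x x' t1 ev G xi th
    using g2 gm ge th xi_linear by unfold_locales (simp_all add: G_def)
  have "G \<in> functors C D"
    using G.splitting_functor by (simp add: functors_def) (simp add: G_def)
  then show ?thesis
    using that G.split_q_system_functor_axioms by blast
qed

lemma (in split_q_system) functor_exists:
  assumes "locally_projection_complete D"
  obtains G xi th where "split_q_system_functor C D F x x' t1 ev G xi th" "G \<in> functors C D"
proof -
  \<comment> \<open>The 1-cell and its unitary are chosen together, since the type of
    \<open>xi\<close> depends on \<open>N\<close>.\<close>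
  let ?P = "\<lambda>X (N, xi). N \<in> Ob1 D \<and> src1 D N = src1 D (x (src1 C X)) \<and>
    tgt1 D N = src1 D (x (tgt1 C X)) \<and>
    xi \<in> Ob2 D \<and> src2 D xi = x (tgt1 C X) \<boxdot> N \<and> tgt2 D xi = fun1 F X \<boxdot> x (src1 C X) \<and>
    star2 D xi \<cdot> xi = id2 D (x (tgt1 C X) \<boxdot> N) \<and>
    xi \<cdot> star2 D xi = id2 D (fun1 F X \<boxdot> x (src1 C X)) \<and>
    xi \<cdot> (x (tgt1 C X) \<rhd> (ev (tgt1 C X) \<lhd> N)) = act X \<cdot> (x (tgt1 C X) \<rhd> (x' (tgt1 C X) \<rhd> xi))"
  have "\<forall>X \<in> Ob1 C. \<exists>p. ?P X p"
    by (rule ballI, rule splitting_exists[OF assms]) auto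
  then obtain p where "\<forall>X \<in> Ob1 C. ?P X (p X)"
    by (rule bchoice[THEN exE])
  then interpret split_q_system_modules C D F x x' t1 ev "fst \<circ> p" "snd \<circ> p"
    by unfold_locales (simp_all add: case_prod_beta)
  \<comment> \<open>The fact \<open>functor_exists\<close> used here comes from the interpretation
    of \<open>split_q_system_modules\<close> for the chosen 1-cells and unitaries.\<close>
  show ?thesis
    using functor_exists that by blast
qed

section \<open>Assembling the splitting in \<open>fun_2cat\<close>\<close>

lemma fun_2cat_q_system_splits:
  fixes C :: "('o, 'm, 'c) two_cat" and D :: "('p, 'n, 'd) two_cat" (structure)
  assumes "strict_cstar_2category C" "strict_cstar_2category D"
    and lpc: "locally_projection_complete D" and complete: "q_system_complete D"
    and q: "q_system (fun_2cat C D) F Q m i"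
  shows "q_system_splits (fun_2cat C D) F Q m i"
proof -
  interpret C: strict_cstar_2category C by fact
  interpret D: strict_cstar_2category D by fact
  let ?E = "fun_2cat C D"
  have F: "F \<in> functors C D"
    and Q: "Q \<in> transformations C D" and Q_type [simp]: "tr_src Q = F" "tr_tgt Q = F"
    and m: "m \<in> modifications C D" and m_type [simp]: "md_src m = transf_comp C D Q Q" "md_tgt m = Q"
    and i: "i \<in> modifications C D" and i_type [simp]: "md_src i = transf_id C D F" "md_tgt i = Q"
    using q by (simp_all add: q_system_def fun_2cat_cells) (simp_all add: fun_2cat_def)
  interpret Q: star_2_transformation C D F F "tr0 Q" "tr1 Q"
    using Q by (auto simp: transformations_def)
  \<comment> \<open>The intermediate 0-cell of each splitting is the source of \<open>x\<close>, so
    it is written as \<open>src1 D x\<close> and not chosen separately.\<close>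
  let ?P = "\<lambda>a (x, x', ev, coev, u). unitarily_separable_left_dual D (src1 D x) (fun0 F a) x x' ev coev \<and>
    q_system_iso D (tr0 Q a) (md m a) (md i a) (x \<boxdot> x') (id2 D x \<boxtimes> ev \<boxtimes> id2 D x') coev u"
  have "\<exists>p. ?P a p" if "a \<in> Ob0 C" for a
  proof -
    have "q_system_splits D (fun0 F a) (tr0 Q a) (md m a) (md i a)"
      using complete q_system_component[OF q that] by (simp add: q_system_complete_def)
    then obtain c x x' ev coev u where
      "unitarily_separable_left_dual D c (fun0 F a) x x' ev coev"
      "q_system_iso D (tr0 Q a) (md m a) (md i a) (x \<boxdot> x') (id2 D x \<boxtimes> ev \<boxtimes> id2 D x') coev u"
      unfolding q_system_splits_def by blast
    moreover from this have "src1 D x = c"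
      by (simp add: unitarily_separable_left_dual_def mem_cells1)
    ultimately have "?P a (x, x', ev, coev, u)"
      by simp
    then show ?thesis by blast
  qed
  then have "\<forall>a \<in> Ob0 C. \<exists>p. ?P a p"
    by blast
  then obtain p where p: "\<forall>a \<in> Ob0 C. ?P a (p a)"
    by (rule bchoice[THEN exE])
  define x x' ev coev u where "x = fst \<circ> p" and "x' = fst \<circ> snd \<circ> p" and "ev = fst \<circ> snd \<circ> snd \<circ> p"
    and "coev = fst \<circ> snd \<circ> snd \<circ> snd \<circ> p" and "u = snd \<circ> snd \<circ> snd \<circ> snd \<circ> p"
  have left_dual: "unitarily_separable_left_dual D (src1 D (x a)) (fun0 F a) (x a) (x' a) (ev a) (coev a)"
    and iso: "q_system_iso D (tr0 Q a) (md m a) (md i a) (x a \<boxdot> x' a)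
      (id2 D (x a) \<boxtimes> ev a \<boxtimes> id2 D (x' a)) (coev a) (u a)" if "a \<in> Ob0 C" for a
    using bspec[OF p that] by (simp_all add: x_def x'_def ev_def coev_def u_def case_prod_beta)
  have sep: "separable_dual D (x a) (x' a) (ev a)" if "a \<in> Ob0 C" for a
    using left_dual[OF that]
    by unfold_locales (simp_all add: unitarily_separable_left_dual_def mem_cells1 mem_cells2)
  have x_type: "x a \<in> Ob1 D" "tgt1 D (x a) = fun0 F a" "x' a \<in> Ob1 D" "src1 D (x' a) = fun0 F a"
      "tgt1 D (x' a) = src1 D (x a)" "ev a \<in> Ob2 D" "src2 D (ev a) = x' a \<boxdot> x a"
      "tgt2 D (ev a) = id1 D (src1 D (x a))" "ev a \<cdot> star2 D (ev a) = id2 D (id1 D (src1 D (x a)))"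
      "coev a \<in> Ob2 D" "src2 D (coev a) = id1 D (fun0 F a)" "tgt2 D (coev a) = x a \<boxdot> x' a"
      if "a \<in> Ob0 C" for a
    using left_dual[OF that] by (simp_all add: unitarily_separable_left_dual_def mem_cells1 mem_cells2)
  have u_type: "u a \<in> Ob2 D" "src2 D (u a) = tr0 Q a" "tgt2 D (u a) = x a \<boxdot> x' a"
      "star2 D (u a) \<cdot> u a = id2 D (tr0 Q a)" "u a \<cdot> star2 D (u a) = id2 D (x a \<boxdot> x' a)"
    and u_mult: "u a \<cdot> md m a = (id2 D (x a) \<boxtimes> ev a \<boxtimes> id2 D (x' a)) \<cdot> (u a \<boxtimes> u a)"
    and u_unit: "u a \<cdot> md i a = coev a"
      if "a \<in> Ob0 C" for a
    using iso[OF that] by (simp_all add: q_system_iso_def unitary2_def mem_cells2)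
  note [simp] = u_type
  have m_comp [simp]: "md m a \<in> Ob2 D" "src2 D (md m a) = tr0 Q a \<boxdot> tr0 Q a" "tgt2 D (md m a) = tr0 Q a"
    and i_comp [simp]: "md i a \<in> Ob2 D" "src2 D (md i a) = id1 D (fun0 F a)" "tgt2 D (md i a) = tr0 Q a"
    if "a \<in> Ob0 C" for a
    using modification_component[OF m that] modification_component[OF i that] that
    by (simp_all add: mem_cells2 transf_comp_def transf_id_def)
  have m_nat: "tr1 Q X \<cdot> (md m (tgt1 C X) \<lhd> fun1 F X) = (fun1 F X \<rhd> md m (src1 C X)) \<cdot>
      ((tr1 Q X \<lhd> tr0 Q (src1 C X)) \<cdot> (tr0 Q (tgt1 C X) \<rhd> tr1 Q X))"
    and i_nat: "tr1 Q X \<cdot> (md i (tgt1 C X) \<lhd> fun1 F X) = fun1 F X \<rhd> md i (src1 C X)"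
    if "X \<in> Ob1 C" for X
    using modification_natural[OF m that] modification_natural[OF i that] that
    by (simp_all add: transf_comp_def transf_id_def)
  \<comment> \<open>The 2-cells of \<open>Q\<close> are transported along \<open>u\<close>, so that
    the underlying 1-cells become \<open>x a \<boxdot> x' a\<close> on the nose.\<close>
  define t1 where "t1 X = (fun1 F X \<rhd> u (src1 C X)) \<cdot> tr1 Q X \<cdot> (star2 D (u (tgt1 C X)) \<lhd> fun1 F X)" for X
  have "star_2_transformation C D F F (\<lambda>a. x a \<boxdot> x' a) t1"
    unfolding t1_def[abs_def] by (rule Q.conjugate_transformation) simp_all
  then interpret split_q_system C D F x x' t1 ev
  proof (intro split_q_system.intro split_q_system_axioms.intro)
    fix X assume X: "X \<in> Ob1 C"
    have "t1 X \<cdot> ((id2 D (x (tgt1 C X)) \<boxtimes> ev (tgt1 C X) \<boxtimes> id2 D (x' (tgt1 C X))) \<lhd> fun1 F X)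
      = (fun1 F X \<rhd> (id2 D (x (src1 C X)) \<boxtimes> ev (src1 C X) \<boxtimes> id2 D (x' (src1 C X)))) \<cdot>
        ((t1 X \<lhd> (x (src1 C X) \<boxdot> x' (src1 C X))) \<cdot> ((x (tgt1 C X) \<boxdot> x' (tgt1 C X)) \<rhd> t1 X))"
      by (rule conjugate_multiplication[where u = u and m = "md m" and ?s1.0 = "tr1 Q" and ?s0.0 = "tr0 Q"
            and m' = "\<lambda>a. id2 D (x a) \<boxtimes> ev a \<boxtimes> id2 D (x' a)"])
        (use X in \<open>simp_all add: Q.star_2_transformation_axioms x_type u_mult m_nat t1_def\<close>)
    then show "t1 X \<cdot> (x (tgt1 C X) \<rhd> (ev (tgt1 C X) \<lhd> x' (tgt1 C X) \<lhd> fun1 F X))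
      = (fun1 F X \<rhd> (x (src1 C X) \<rhd> (ev (src1 C X) \<lhd> x' (src1 C X)))) \<cdot>
        ((t1 X \<lhd> x (src1 C X) \<lhd> x' (src1 C X)) \<cdot> (x (tgt1 C X) \<rhd> (x' (tgt1 C X) \<rhd> t1 X)))"
      using X by (simp add: x_type t1_def)
  qed (use sep in blast)+
  obtain G xi th where "split_q_system_functor C D F x x' t1 ev G xi th" and G: "G \<in> functors C D"
    by (rule functor_exists[OF lpc])
  then interpret split_q_system_functor C D F x x' t1 ev G xi th
    by simp
  define X where "X = \<lparr>tr_src = G, tr_tgt = F, tr0 = restrict x (Ob0 C), tr1 = restrict xi (Ob1 C)\<rparr>"
  define X' where "X' = \<lparr>tr_src = F, tr_tgt = G, tr0 = restrict x' (Ob0 C), tr1 = restrict th (Ob1 C)\<rparr>"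
  have X: "X \<in> transformations C D" and X': "X' \<in> transformations C D"
    unfolding X_def X'_def
    by (intro transformationsI F G splitting_transformation dual_transformation)+
  have XX': "transf_comp C D X X' \<in> transformations C D"
    and X'X: "transf_comp C D X' X \<in> transformations C D"
    by (intro transf_comp_in X X'; simp add: X_def X'_def)+
  define Ev where "Ev = \<lparr>md_src = transf_comp C D X' X, md_tgt = transf_id C D G, md = restrict ev (Ob0 C)\<rparr>"
  define Coev where "Coev = \<lparr>md_src = transf_id C D F, md_tgt = transf_comp C D X X', md = restrict coev (Ob0 C)\<rparr>"
  define U where "U = \<lparr>md_src = Q, md_tgt = transf_comp C D X X', md = restrict u (Ob0 C)\<rparr>"
  have Ev: "Ev \<in> modifications C D"
    unfolding Ev_def
  proof (rule modificationsI[where B = 1])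
    show "norm2 D (ev a) \<le> 1" if "a \<in> Ob0 C" for a
      using that by (intro D.norm2_coisometry_le) simp_all
    fix Y assume [simp]: "Y \<in> Ob1 C"
    show "tr1 (transf_id C D G) Y \<cdot> (ev (tgt1 C Y) \<lhd> fun1 G Y)
        = (fun1 G Y \<rhd> ev (src1 C Y)) \<cdot> tr1 (transf_comp C D X' X) Y"
      using ev_natural[of Y] by (simp add: transf_comp_def transf_id_def X_def X'_def)
  qed (use X'X transf_id_in[OF G] in
      \<open>simp_all add: transf_comp_def transf_id_def X_def X'_def mem_cells2\<close>)
  have u_bound: "norm2 D (u a) \<le> 1" if "a \<in> Ob0 C" for a
    using that by (intro D.norm2_isometry_le) simp_all
  have U: "U \<in> modifications C D"
    unfolding U_def
  proof (rule modificationsI[where B = 1])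
    fix Y assume [simp]: "Y \<in> Ob1 C"
    \<comment> \<open>By \<open>xi_th\<close> the 2-cell of \<open>X\<close> after \<open>X'\<close>
      is \<open>t1 Y\<close>, which is by construction the conjugate of \<open>tr1 Q Y\<close> by
      \<open>u\<close>.\<close>
    show "tr1 (transf_comp C D X X') Y \<cdot> (u (tgt1 C Y) \<lhd> fun1 F Y)
        = (fun1 F Y \<rhd> u (src1 C Y)) \<cdot> tr1 Q Y"
      by (simp add: transf_comp_def X_def X'_def xi_th t1_def D.cancel)
  qed (use XX' Q u_bound in \<open>simp_all add: transf_comp_def X_def X'_def mem_cells2\<close>)
  \<comment> \<open>The bound for \<open>coev\<close> is inherited from the unit: each
    \<open>coev a\<close> is \<open>u a \<cdot> md i a\<close>, and \<open>i\<close>, being a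
    modification, is uniformly bounded.\<close>
  obtain B where B: "\<And>a. a \<in> Ob0 C \<Longrightarrow> norm2 D (md i a) \<le> B"
  proof -
    interpret I: star_2_modification C D F F "tr0 (md_src i)" "tr1 (md_src i)" "tr0 Q" "tr1 Q" "md i"
      using i by (auto simp: modifications_def transf_id_def)
    show ?thesis
      using I.mod_bounded that by (auto simp: bdd_above_def)
  qed
  have Coev: "Coev \<in> modifications C D"
    unfolding Coev_def
  proof (rule modificationsI[where B = B])
    show "norm2 D (coev a) \<le> B" if a: "a \<in> Ob0 C" for a
    proof -
      have "norm2 D (coev a) \<le> norm2 D (u a) * norm2 D (md i a)"
        unfolding u_unit[OF a, symmetric] by (rule D.norm2_vcomp_le) (use a in simp_all)
      also have "\<dots> \<le> 1 * norm2 D (md i a)"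
        using u_bound a by (intro mult_right_mono D.norm2_nonneg) simp_all
      finally show ?thesis
        using B[OF a] by simp
    qed
    fix Y assume [simp]: "Y \<in> Ob1 C"
    show "tr1 (transf_comp C D X X') Y \<cdot> (coev (tgt1 C Y) \<lhd> fun1 F Y)
        = (fun1 F Y \<rhd> coev (src1 C Y)) \<cdot> tr1 (transf_id C D F) Y"
      by (simp add: transf_comp_def transf_id_def X_def X'_def xi_th t1_def D.cancel i_nat flip: u_unit)
  qed (use XX' transf_id_in[OF F] in
      \<open>simp_all add: transf_comp_def transf_id_def X_def X'_def mem_cells2 x_type\<close>)
  \<comment> \<open>Modifications record their source and target, so the zig-zag equations also
    require the outer 1-cells of both sides to coincide; these strict unit laws ensure it.\<close>
  have unit_laws [simp]: "transf_comp C D (transf_id C D F) X = X" "transf_comp C D X (transf_id C D G) = X"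
    "transf_comp C D (transf_id C D G) X' = X'" "transf_comp C D X' (transf_id C D F) = X'"
    using transf_comp_id[OF X] transf_comp_id[OF X'] by (simp_all add: X_def X'_def)
  have tr0 [simp]: "tr0 X a = x a" "tr0 X' a = x' a" "tr0 (transf_id C D G) a = id1 D (src1 D (x a))"
      "tr0 (transf_comp C D X X') a = x a \<boxdot> x' a"
    if "a \<in> Ob0 C" for a
    using that by (simp_all add: X_def X'_def transf_id_def transf_comp_def)
  have "unitarily_separable_left_dual ?E G F X X' Ev Coev"
    unfolding unitarily_separable_left_dual_def
  proof (intro conjI)
    show "X \<in> cells1 ?E G F" "X' \<in> cells1 ?E F G"
      using X X' by (simp_all add: fun_2cat_cells X_def X'_def)
    show "Ev \<in> cells2 ?E (X' \<boxdot>\<^bsub>?E\<^esub> X) (id1 ?E G)" "Coev \<in> cells2 ?E (id1 ?E F) (X \<boxdot>\<^bsub>?E\<^esub> X')"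
      using Ev Coev by (simp_all add: fun_2cat_cells) (simp_all add: fun_2cat_def Ev_def Coev_def)
    show "(id2 ?E X \<boxtimes>\<^bsub>?E\<^esub> Ev) \<cdot>\<^bsub>?E\<^esub> (Coev \<boxtimes>\<^bsub>?E\<^esub> id2 ?E X) = id2 ?E X"
      "(Ev \<boxtimes>\<^bsub>?E\<^esub> id2 ?E X') \<cdot>\<^bsub>?E\<^esub> (id2 ?E X' \<boxtimes>\<^bsub>?E\<^esub> Coev) = id2 ?E X'"
      "Ev \<cdot>\<^bsub>?E\<^esub> star2 ?E Ev = id2 ?E (id1 ?E G)"
      using left_dual by (simp_all add: fun_2cat_def Ev_def Coev_def unitarily_separable_left_dual_def
          fun_eq_iff)
  qed
  moreover have "q_system_iso ?E Q m i (X \<boxdot>\<^bsub>?E\<^esub> X') (id2 ?E X \<boxtimes>\<^bsub>?E\<^esub> Ev \<boxtimes>\<^bsub>?E\<^esub> id2 ?E X') Coev U"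
    unfolding q_system_iso_def unitary2_def
  proof (intro conjI)
    show "U \<in> cells2 ?E Q (X \<boxdot>\<^bsub>?E\<^esub> X')"
      using U by (simp add: fun_2cat_cells) (simp add: fun_2cat_def U_def)
    show "star2 ?E U \<cdot>\<^bsub>?E\<^esub> U = id2 ?E Q" "U \<cdot>\<^bsub>?E\<^esub> star2 ?E U = id2 ?E (X \<boxdot>\<^bsub>?E\<^esub> X')"
      by (simp_all add: fun_2cat_def U_def fun_eq_iff)
    show "U \<cdot>\<^bsub>?E\<^esub> m = (id2 ?E X \<boxtimes>\<^bsub>?E\<^esub> Ev \<boxtimes>\<^bsub>?E\<^esub> id2 ?E X') \<cdot>\<^bsub>?E\<^esub> (U \<boxtimes>\<^bsub>?E\<^esub> U)"
      using u_mult by (simp add: fun_2cat_def U_def Ev_def fun_eq_iff)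
    show "U \<cdot>\<^bsub>?E\<^esub> i = Coev"
      using u_unit by (simp add: fun_2cat_def U_def Coev_def fun_eq_iff)
  qed
  moreover have "G \<in> Ob0 ?E"
    using G by (simp add: fun_2cat_cells)
  ultimately show ?thesis
    unfolding q_system_splits_def by blast
qed

theorem theorem1p1:
  fixes C :: "('o, 'm, 'c) two_cat" and D :: "('p, 'n, 'd) two_cat"
  assumes "strict_cstar_2category C" and "locally_projection_complete C"
    and "strict_cstar_2category D" and "locally_projection_complete D"
    and "q_system_complete D"
  shows "q_system_complete (fun_2cat C D)"
  using fun_2cat_q_system_splits[OF assms(1,3-5)] by (simp add: q_system_complete_def)

end
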